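(* Let $\mathcal D=\mathcal D(v,r;k_1,k_2)$. (a) If $\gamma\le\frac{r-1}{r}$, then every group-affine design in $\mathcal D$ whose number of groups $n$ satisfies $n\le n_\gamma$ is E-optimal over $\mathcal D$. (b) If $\gamma\le\frac{r-1}{r}$ and at least one group-affine design in $\mathcal D$ with $n\le n_\gamma$ exists, then the class $\mathcal D_E$ of all E-optimal designs in $\mathcal D$ is exactly the class of all group-affine designs in $\mathcal D$ with $n\le n_\gamma$. (c) If $\gamma\ge\frac{r-1}{r}$, then every $\mathrm{ECD}(\bar\theta+1)$ in $\mathcal D$ is Schur-optimal over $\mathcal D$.
   Context: Let $k_1\ge k_2\ge 2$ be integers, $v=k_1+k_2$, and $2\le r\le v-1$. A resolvable design $d$ consists of $r$ replicates, each replicate being a partition of a fixed set of $v$ treatments into two blocks, one of size $k_1$ and one of size $k_2$ (if $k_1=k_2$, one block of each replicate is designated as "the block of size $k_1$"). Let $N_d$ be the $v\times 2r$ zero-one treatment/block incidence matrix, $D_s=\mathrm{Diag}(k_1,k_2,k_1,k_2,\dots,k_1,k_2)$ the diagonal matrix of block sizes, and $C_d=rI-N_dD_s^{-1}N_d'$ the information matrix. The design is connected if $C_d$ has rank $v-1$; only connected designs are considered, and $\mathcal D(v,r;k_1,k_2)$ denotes the class of all of them. The nonzero eigenvalues of $C_d$ are $z_{d1}\le z_{d2}\le\dots\le z_{d,v-1}$. For $h\ne h'$, $\phi_{dhh'}$ is the number of treatments common to the blocks of size $k_1$ in replicates $h$ and $h'$. A design $d$ is an equal concurrence design $\mathrm{ECD}(\theta)$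 if $\phi_{dhh'}=\theta$ for all $h\neq h'$. Put $\bar\theta=\lfloor k_1^2/(k_1+k_2)\rfloor$, $\gamma=k_1^2/(k_1+k_2)-\bar\theta\in[0,1)$ and $n_\gamma=\lfloor 1/(1-\gamma)\rfloor$. A design $d$ is group-affine with $n$ groups of sizes $t_1\le t_2\le\dots\le t_n$ (positive integers, $\sum_i t_i=r$) if the $r$ replicates can be partitioned into $n$ groups of these sizes so that $\phi_{dhh'}=\bar\theta$ whenever $h\ne h'$ are in the same group and $\phi_{dhh'}=\bar\theta+1$ whenever $h,h'$ are in different groups. A design is E-optimal if it maximizes $z_{d1}$ over $\mathcal D$. A design is Schur-optimal if it minimizes $\sum_{i=1}^{v-1}f(z_{di})$ over $\mathcal D$ for every convex $f:(0,\infty)\to\mathbb R$. *)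

theory Defs
  imports
    "Jordan_Normal_Form.Char_Poly"
    "Jordan_Normal_Form.DL_Rank"
    "Jordan_Normal_Form.Gauss_Jordan_Elimination"
    "HOL-Library.Disjoint_Sets"
    "HOL-Library.FuncSet"
    "HOL-Analysis.Convex"
begin

text \<open>The \<open>v = k1 + k2\<close> treatments are \<open>0, \<dots>, v - 1\<close> and the \<open>r\<close> replicates are indexed by
  \<open>0, \<dots>, r - 1\<close>. A replicate is the ordered pair of its block of size \<open>k1\<close> and its block of
  size \<open>k2\<close>; for \<open>k1 = k2\<close> the order records which block is designated the block of size \<open>k1\<close>.\<close>

type_synonym design = "nat \<Rightarrow> nat set \<times> nat set"

definition replicates :: "nat \<Rightarrow> nat \<Rightarrow> (nat set \<times> nat set) set" where
  "replicates k1 k2 =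
     {(A, B). A \<union> B = {..<k1 + k2} \<and> A \<inter> B = {} \<and> card A = k1 \<and> card B = k2}"

definition resolvable_designs :: "nat \<Rightarrow> nat \<Rightarrow> nat \<Rightarrow> design set" where
  "resolvable_designs r k1 k2 = {..<r} \<rightarrow>\<^sub>E replicates k1 k2"

text \<open>Columns \<open>2 h\<close> and \<open>2 h + 1\<close> belong to the blocks of size \<open>k1\<close> and \<open>k2\<close> of replicate \<open>h\<close>.\<close>

definition block :: "design \<Rightarrow> nat \<Rightarrow> nat set" where
  "block d j = (if even j then fst (d (j div 2)) else snd (d (j div 2)))"

definition incidence_mat :: "nat \<Rightarrow> nat \<Rightarrow> nat \<Rightarrow> design \<Rightarrow> real mat" where
  "incidence_mat r k1 k2 d = mat (k1 + k2) (2 * r) (\<lambda>(i, j). if i \<in> block d j then 1 else 0)"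

definition block_size_mat :: "nat \<Rightarrow> nat \<Rightarrow> nat \<Rightarrow> real mat" where
  "block_size_mat r k1 k2 = mat_diag (2 * r) (\<lambda>j. if even j then real k1 else real k2)"

definition information_mat :: "nat \<Rightarrow> nat \<Rightarrow> nat \<Rightarrow> design \<Rightarrow> real mat" where
  "information_mat r k1 k2 d =
     real r \<cdot>\<^sub>m 1\<^sub>m (k1 + k2)
     - incidence_mat r k1 k2 d * the (mat_inverse (block_size_mat r k1 k2))
       * transpose_mat (incidence_mat r k1 k2 d)"

text \<open>\<^const>\<open>mat_inverse\<close> is option-valued; here the inverse does exist.\<close>

lemma mat_inverse_block_size_mat:
  assumes "k1 > 0" "k2 > 0"
  shows "mat_inverse (block_size_mat r k1 k2) =
    Some (mat_diag (2 * r) (\<lambda>j. if even j then 1 / real k1 else 1 / real k2))"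
proof -
  let ?n = "2 * r"
  let ?D = "block_size_mat r k1 k2"
  let ?E = "mat_diag ?n (\<lambda>j. if even j then 1 / real k1 else 1 / real k2)"
  have D: "?D \<in> carrier_mat ?n ?n" and E: "?E \<in> carrier_mat ?n ?n"
    by (simp_all add: block_size_mat_def)
  have "(\<lambda>j::nat. (if even j then real k1 else real k2)
        * (if even j then 1 / real k1 else 1 / real k2)) = (\<lambda>_. 1)"
       "(\<lambda>j::nat. (if even j then 1 / real k1 else 1 / real k2)
        * (if even j then real k1 else real k2)) = (\<lambda>_. 1)"
    using assms by (auto simp: fun_eq_iff)
  then have DE: "?D * ?E = 1\<^sub>m ?n" and ED: "?E * ?D = 1\<^sub>m ?n"
    unfolding block_size_mat_def mat_diag_diag by (simp_all only: mat_diag_one)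
  have "?D \<in> Units (ring_mat TYPE(real) ?n ())"
    using D E DE ED by (auto simp: Units_def ring_mat_def)
  with mat_inverse(1)[OF D, where b = "()"] obtain B where B: "mat_inverse ?D = Some B"
    by (cases "mat_inverse ?D") auto
  from mat_inverse(2)[OF D B] have B': "B * ?D = 1\<^sub>m ?n" "B \<in> carrier_mat ?n ?n" by auto
  have "B = B * (?D * ?E)" using DE B' by simp
  also have "\<dots> = (B * ?D) * ?E" using assoc_mult_mat[OF B'(2) D E] by simp
  also have "\<dots> = ?E" unfolding B'(1) by (rule left_mult_one_mat[OF E])
  finally show ?thesis using B by simp
qed

definition connected_design :: "nat \<Rightarrow> nat \<Rightarrow> nat \<Rightarrow> design \<Rightarrow> bool" where
  "connected_design r k1 k2 d \<longleftrightarrow>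
     vec_space.rank (k1 + k2) (information_mat r k1 k2 d) = k1 + k2 - 1"

definition design_class :: "nat \<Rightarrow> nat \<Rightarrow> nat \<Rightarrow> design set" where
  "design_class r k1 k2 = {d \<in> resolvable_designs r k1 k2. connected_design r k1 k2 d}"

text \<open>The roots of the characteristic polynomial are taken with multiplicity. The information
  matrix is real symmetric, so all its eigenvalues are real, and for a connected design the
  list has length \<open>v - 1\<close>. The \<open>i\<close>-th eigenvalue is numbered from \<open>1\<close>.\<close>

definition nonzero_eigenvalues :: "nat \<Rightarrow> nat \<Rightarrow> nat \<Rightarrow> design \<Rightarrow> real list" where
  "nonzero_eigenvalues r k1 k2 d =
     sorted_list_of_multiset
       (filter_mset (\<lambda>x. x \<noteq> 0) (proots (char_poly (information_mat r k1 k2 d))))"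

definition eigval :: "nat \<Rightarrow> nat \<Rightarrow> nat \<Rightarrow> design \<Rightarrow> nat \<Rightarrow> real" where
  "eigval r k1 k2 d i = nonzero_eigenvalues r k1 k2 d ! (i - 1)"

definition concurrence :: "design \<Rightarrow> nat \<Rightarrow> nat \<Rightarrow> nat" where
  "concurrence d h h' = card (fst (d h) \<inter> fst (d h'))"

definition equal_concurrence :: "nat \<Rightarrow> design \<Rightarrow> nat \<Rightarrow> bool" where
  "equal_concurrence r d \<theta> \<longleftrightarrow> (\<forall>h<r. \<forall>h'<r. h \<noteq> h' \<longrightarrow> concurrence d h h' = \<theta>)"

definition theta_bar :: "nat \<Rightarrow> nat \<Rightarrow> nat" where
  "theta_bar k1 k2 = nat \<lfloor>real k1 ^ 2 / real (k1 + k2)\<rfloor>"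

definition gamma :: "nat \<Rightarrow> nat \<Rightarrow> real" where
  "gamma k1 k2 = real k1 ^ 2 / real (k1 + k2) - real (theta_bar k1 k2)"

definition n_gamma :: "nat \<Rightarrow> nat \<Rightarrow> nat" where
  "n_gamma k1 k2 = nat \<lfloor>1 / (1 - gamma k1 k2)\<rfloor>"

definition group_affine_sizes :: "nat \<Rightarrow> nat \<Rightarrow> nat \<Rightarrow> design \<Rightarrow> nat \<Rightarrow> nat list \<Rightarrow> bool" where
  "group_affine_sizes r k1 k2 d n t \<longleftrightarrow>
     length t = n \<and> sorted t \<and> (\<forall>i<n. 0 < t ! i) \<and> sum_list t = r \<and>
     (\<exists>G :: nat \<Rightarrow> nat set.
        disjoint_family_on G {..<n} \<and> (\<Union>i<n. G i) = {..<r} \<and> (\<forall>i<n. card (G i) = t ! i) \<and>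
        (\<forall>i<n. \<forall>h\<in>G i. \<forall>h'\<in>G i. h \<noteq> h' \<longrightarrow> concurrence d h h' = theta_bar k1 k2) \<and>
        (\<forall>i<n. \<forall>j<n. i \<noteq> j \<longrightarrow>
           (\<forall>h\<in>G i. \<forall>h'\<in>G j. concurrence d h h' = theta_bar k1 k2 + 1)))"

definition group_affine :: "nat \<Rightarrow> nat \<Rightarrow> nat \<Rightarrow> design \<Rightarrow> nat \<Rightarrow> bool" where
  "group_affine r k1 k2 d n \<longleftrightarrow> (\<exists>t. group_affine_sizes r k1 k2 d n t)"

definition E_optimal :: "nat \<Rightarrow> nat \<Rightarrow> nat \<Rightarrow> design \<Rightarrow> bool" where
  "E_optimal r k1 k2 d \<longleftrightarrow>
     d \<in> design_class r k1 k2 \<and>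
     (\<forall>d'\<in>design_class r k1 k2. eigval r k1 k2 d' 1 \<le> eigval r k1 k2 d 1)"

definition Schur_optimal :: "nat \<Rightarrow> nat \<Rightarrow> nat \<Rightarrow> design \<Rightarrow> bool" where
  "Schur_optimal r k1 k2 d \<longleftrightarrow>
     d \<in> design_class r k1 k2 \<and>
     (\<forall>f :: real \<Rightarrow> real. convex_on {0<..} f \<longrightarrow>
        (\<forall>d'\<in>design_class r k1 k2.
           (\<Sum>i = 1..k1 + k2 - 1. f (eigval r k1 k2 d i))
           \<le> (\<Sum>i = 1..k1 + k2 - 1. f (eigval r k1 k2 d' i))))"

end

theory Submission
  imports Defs "Jordan_Normal_Form.Schur_Decomposition"
begin

text \<open>
  Write \<open>v = k1 + k2\<close>. The two blocks \<open>A\<close> and \<open>B\<close> of a replicate partition the treatments, so with their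
  indicator vectors the matrix \<open>1_A 1_A'/k1 + 1_B 1_B'/k2\<close> is the orthogonal projection onto a plane
  containing the constant vector, namely \<open>J/v + x x'\<close> for a unit vector \<open>x\<close> orthogonal to the constants. Collecting these
  contrasts as the columns of a matrix \<open>X\<close> gives \<open>C = r (I - J/v) - X X'\<close>. The matrices \<open>X X'\<close> and
  \<open>G = X' X\<close> have the same nonzero eigenvalues, so the spectrum of \<open>C\<close> consists of \<open>0\<close>, of
  \<open>v - 1 - r\<close> copies of \<open>r\<close>, and of \<open>r - \<mu>\<close> for the \<open>r\<close> eigenvalues \<open>\<mu>\<close> of \<open>G\<close>; connectedness says
  that every \<open>\<mu>\<close> is less than \<open>r\<close>. Optimality is thereby a question about the \<open>r \<times> r\<close> matrix \<open>G\<close>.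

  The matrix \<open>G\<close> has unit diagonal, and its other entries are \<open>c (\<phi> - \<theta> - \<gamma>)\<close> with \<open>c = v / (k1 k2)\<close> and
  \<open>\<theta> = \<lfloor>k1\<^sup>2 / v\<rfloor>\<close>. With \<open>D = \<phi> - \<theta>\<close> off the diagonal and \<open>D = 0\<close> on it, its quadratic form is
  \<open>s'Gs = (1 + c \<gamma>) |s|\<^sup>2 + c (s'Ds - \<gamma> (\<Sum>s)\<^sup>2)\<close>.

  Lower bound for the largest eigenvalue \<open>\<mu>\<^sub>1\<close> of \<open>G\<close>: if two replicates have \<open>\<phi> \<le> \<theta>\<close>, the
  difference of their coordinate vectors shows \<open>\<mu>\<^sub>1 \<ge> 1 + c \<gamma>\<close>; otherwise \<open>D \<ge> 1\<close> off the diagonal,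
  and the all-one vector shows \<open>\<mu>\<^sub>1 \<ge> 1 + (r - 1) c (1 - \<gamma>)\<close> (\<open>G_quad_bound_lower\<close>). The comparison
  of \<open>\<gamma>\<close> with \<open>(r - 1)/r\<close> decides which of the two bounds is the smaller one.

  When \<open>\<gamma> \<le> (r - 1)/r\<close>, the universal bound is therefore \<open>1 + c \<gamma>\<close>, and it is attained exactly
  when \<open>s'Ds \<le> \<gamma> (\<Sum>s)\<^sup>2\<close> for all \<open>s\<close>. This inequality characterizes the group-affine designs with
  \<open>n (1 - \<gamma>) \<le> 1\<close> (\<open>group_affine_iff_excess\<close>): in one direction \<open>s'Ds\<close> is \<open>(\<Sum>s)\<^sup>2\<close> minus the sum of
  the squared group totals, and the Cauchy-Schwarz inequality applies; in the other direction, test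
  vectors supported on two or three replicates force \<open>D\<close> to take only the values \<open>0\<close> and \<open>1\<close> and
  make \<open>D = 0\<close> an equivalence relation, whose classes are the groups, and the indicator of a set of
  representatives bounds their number.

  When \<open>\<gamma> \<ge> (r - 1)/r\<close>, the universal bound is \<open>1 + (r - 1) c (1 - \<gamma>)\<close>. An equal concurrence design
  for \<open>\<theta> + 1\<close> has this as its largest eigenvalue, and all its other eigenvalues coincide. Since \<open>G\<close>
  always has trace \<open>r\<close>, the spectrum of every design is at least as spread out, and a sum of convex
  values can only grow (\<open>two_level_mset_minimizes_convex_sum\<close>).
\<close>

section \<open>Characteristic polynomials of products\<close>

lemma char_poly_matrix_eq:
  fixes M :: "'a::comm_ring_1 mat"
  assumes "M \<in> carrier_mat k k"
  shows "char_poly_matrix M = [:0, 1:] \<cdot>\<^sub>m 1\<^sub>m k - map_mat (\<lambda>a. [:a:]) M"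
  unfolding char_poly_matrix_def by (rule eq_matI) (use assms in auto)

text \<open>Both sides are determinants of the block matrix with rows \<open>(x I, P)\<close> and \<open>(Q, I)\<close>, up to powers
  of \<open>x\<close>: multiplying it by suitable block triangular matrices on the right, respectively on the left,
  clears the lower left block. Neither step divides by \<open>x\<close>, so \<open>x\<close> may be an indeterminate.\<close>

lemma det_smult_one_minus_mult_commute:
  fixes P Q :: "'a::idom mat"
  assumes P: "P \<in> carrier_mat n m" and Q: "Q \<in> carrier_mat m n"
  shows "x ^ m * det (x \<cdot>\<^sub>m 1\<^sub>m n - P * Q) = x ^ n * det (x \<cdot>\<^sub>m 1\<^sub>m m - Q * P)"
proof -
  let ?I = "\<lambda>k. 1\<^sub>m k :: 'a mat"
  let ?F = "four_block_mat (x \<cdot>\<^sub>m ?I n) P Q (?I m)"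
  let ?R = "four_block_mat (?I n) (0\<^sub>m n m) (- Q) (?I m)"
  let ?L = "four_block_mat (?I n) (0\<^sub>m n m) (- Q) (x \<cdot>\<^sub>m ?I m)"
  have F: "?F \<in> carrier_mat (n + m) (n + m)" and R: "?R \<in> carrier_mat (n + m) (n + m)"
    and L: "?L \<in> carrier_mat (n + m) (n + m)" by auto
  have c: "x \<cdot>\<^sub>m ?I n - P * Q \<in> carrier_mat n n" "x \<cdot>\<^sub>m ?I m - Q * P \<in> carrier_mat m m"
    "?I m \<in> carrier_mat m m" "?I n \<in> carrier_mat n n" "x \<cdot>\<^sub>m ?I n \<in> carrier_mat n n"
    "x \<cdot>\<^sub>m ?I m \<in> carrier_mat m m" "- Q \<in> carrier_mat m n"
    using P Q by auto
  have e: "x \<cdot>\<^sub>m ?I n * ?I n + P * - Q = x \<cdot>\<^sub>m ?I n - P * Q" 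
     "x \<cdot>\<^sub>m ?I n * 0\<^sub>m n m + P * ?I m = P" "Q * ?I n + ?I m * - Q = 0\<^sub>m m n"
     "Q * 0\<^sub>m n m + ?I m * ?I m = ?I m"
     "?I n * (x \<cdot>\<^sub>m ?I n) + 0\<^sub>m n m * Q = x \<cdot>\<^sub>m ?I n" "?I n * P + 0\<^sub>m n m * ?I m = P"
     "- Q * (x \<cdot>\<^sub>m ?I n) + x \<cdot>\<^sub>m ?I m * Q = 0\<^sub>m m n"
     "- Q * P + x \<cdot>\<^sub>m ?I m * ?I m = x \<cdot>\<^sub>m ?I m - Q * P"
    by (rule eq_matI; use P Q in auto)+
  \<comment> \<open>The right factor \<open>?R\<close> clears the lower left block of \<open>?F\<close>, and so does the left factor \<open>?L\<close>.\<close>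
  have FR: "?F * ?R = four_block_mat (x \<cdot>\<^sub>m ?I n - P * Q) P (0\<^sub>m m n) (?I m)"
    unfolding mult_four_block_mat[OF c(5) P Q c(3) c(4) zero_carrier_mat c(7) c(3)] e ..
  have LF: "?L * ?F = four_block_mat (x \<cdot>\<^sub>m ?I n) P (0\<^sub>m m n) (x \<cdot>\<^sub>m ?I m - Q * P)"
    unfolding mult_four_block_mat[OF c(4) zero_carrier_mat c(7) c(6) c(5) P Q c(3)] e ..
  have dI: "det (x \<cdot>\<^sub>m ?I k) = x ^ k" for k by simp
  have "det ?F * det ?R = det (x \<cdot>\<^sub>m ?I n - P * Q)"
    unfolding det_mult[OF F R, symmetric] FR
      det_four_block_mat_lower_left_zero[OF c(1) P refl c(3)] by simp
  moreover have "det ?R = 1"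
    unfolding det_four_block_mat_upper_right_zero[OF c(4) refl c(7) c(3)] by simp
  moreover have "det ?L * det ?F = x ^ n * det (x \<cdot>\<^sub>m ?I m - Q * P)"
    unfolding det_mult[OF L F, symmetric] LF
      det_four_block_mat_lower_left_zero[OF c(5) P refl c(2)] dI ..
  moreover have "det ?L = x ^ m"
    unfolding det_four_block_mat_upper_right_zero[OF c(4) refl c(7) c(6)] dI by simp
  ultimately show ?thesis by simp
qed

text \<open>Sylvester's identity: the determinant identity above over the polynomial ring, taken at the
  indeterminate.\<close>

lemma char_poly_mult_commute:
  fixes A B :: "'a::idom mat"
  assumes A: "A \<in> carrier_mat n m" and B: "B \<in> carrier_mat m n"
  shows "[:0, 1:] ^ m * char_poly (A * B) = [:0, 1:] ^ n * char_poly (B * A)"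
proof -
  let ?C = "map_mat (\<lambda>a. [:a:])" and ?x = "[:0, 1:] :: 'a poly"
  have "char_poly (A * B) = det (?x \<cdot>\<^sub>m 1\<^sub>m n - ?C A * ?C B)"
    unfolding char_poly_def char_poly_matrix_eq[OF mult_carrier_mat[OF A B]] map_poly_mult(1)[OF A B] ..
  moreover have "char_poly (B * A) = det (?x \<cdot>\<^sub>m 1\<^sub>m m - ?C B * ?C A)"
    unfolding char_poly_def char_poly_matrix_eq[OF mult_carrier_mat[OF B A]] map_poly_mult(1)[OF B A] ..
  ultimately show ?thesis
    using det_smult_one_minus_mult_commute[of "?C A" n m "?C B" ?x] A B by simp
qed

lemma char_poly_nonzero: "(A :: 'a::idom mat) \<in> carrier_mat n n \<Longrightarrow> char_poly A \<noteq> 0"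
  using degree_monic_char_poly[of A n] by auto

lemma proots_char_poly_mult_commute:
  fixes A B :: "'a::idom mat"
  assumes A: "A \<in> carrier_mat n m" and B: "B \<in> carrier_mat m n" and "m \<le> n"
  shows "proots (char_poly (A * B)) = replicate_mset (n - m) 0 + proots (char_poly (B * A))"
proof -
  have AB: "char_poly (A * B) \<noteq> 0" and BA: "char_poly (B * A) \<noteq> 0"
    using A B by (auto intro!: char_poly_nonzero)
  have x: "proots ([:0, 1:] ^ k :: 'a poly) = replicate_mset k 0" for k
    by (simp add: proots_power)
  have "replicate_mset m 0 + proots (char_poly (A * B)) = proots ([:0, 1:] ^ m * char_poly (A * B))"
    using AB by (subst proots_mult) (auto simp: x)
  also have "\<dots> = replicate_mset n 0 + proots (char_poly (B * A))"
    unfolding char_poly_mult_commute[OF A B] using BA by (subst proots_mult) (auto simp: x)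
  also have "\<dots> = replicate_mset m 0 + (replicate_mset (n - m) 0 + proots (char_poly (B * A)))"
    using \<open>m \<le> n\<close> by (intro multiset_eqI) simp
  finally show ?thesis by simp
qed

section \<open>Spectra of real symmetric matrices\<close>

text \<open>A complex eigenvector \<open>w\<close> exists by the fundamental theorem of algebra. The Hermitian form
  \<open>w\<^sup>* A w\<close> is its own conjugate, which makes the eigenvalue real; then the real and the imaginary part
  of \<open>w\<close> satisfy the eigenvalue equation, and one of them is nonzero.\<close>

lemma real_symmetric_has_eigenvector:
  fixes A :: "real mat"
  assumes A: "A \<in> carrier_mat n n" and sym: "transpose_mat A = A" and "n > 0"
  obtains v e where "v \<in> carrier_vec n" "v \<noteq> 0\<^sub>v n" "A *\<^sub>v v = e \<cdot>\<^sub>v v"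
proof -
  let ?A = "map_mat complex_of_real A"
  have cA: "?A \<in> carrier_mat n n" using A by simp
  from char_poly_factorized[OF cA] obtain as where
    as: "char_poly ?A = (\<Prod>a\<leftarrow>as. [:- a, 1:])" "length as = n" by auto
  with \<open>n > 0\<close> obtain z as' where "as = z # as'" by (cases as) auto
  with as have "poly (char_poly ?A) z = 0" by simp
  then have "eigenvalue ?A z" by (simp add: eigenvalue_root_char_poly[OF cA])
  then obtain w where w: "w \<in> carrier_vec n" "w \<noteq> 0\<^sub>v n" "?A *\<^sub>v w = z \<cdot>\<^sub>v w"
    unfolding eigenvalue_def eigenvector_def using A by auto
  have Aw: "(\<Sum>j<n. of_real (A $$ (i, j)) * w $ j) = z * w $ i" if "i < n" for i
    using arg_cong[OF w(3), of "\<lambda>u. u $ i"] that A w(1)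
    by (simp add: scalar_prod_def atLeast0LessThan)
  define Q where "Q = (\<Sum>i<n. \<Sum>j<n. cnj (w $ i) * of_real (A $$ (i, j)) * w $ j)"
  define N where "N = (\<Sum>i<n. (cmod (w $ i))\<^sup>2)"
  have "Q = (\<Sum>i<n. cnj (w $ i) * (\<Sum>j<n. of_real (A $$ (i, j)) * w $ j))"
    unfolding Q_def by (simp add: sum_distrib_left mult.assoc)
  also have "\<dots> = z * (\<Sum>i<n. cnj (w $ i) * w $ i)"
    by (simp add: Aw sum_distrib_left mult.left_commute)
  also have "(\<Sum>i<n. cnj (w $ i) * w $ i) = of_real N"
    unfolding N_def of_real_sum by (intro sum.cong refl) (metis complex_norm_square mult.commute)
  finally have QN: "Q = z * of_real N" .
  have "A $$ (i, j) = A $$ (j, i)" if "i < n" "j < n" for i j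
    using arg_cong[OF sym, of "\<lambda>M. M $$ (i, j)"] that A by simp
  then have "cnj Q = (\<Sum>i<n. \<Sum>j<n. cnj (w $ j) * of_real (A $$ (j, i)) * w $ i)"
    unfolding Q_def by (simp add: mult_ac)
  also have "\<dots> = Q" unfolding Q_def by (rule sum.swap)
  finally have "cnj Q = Q" .
  moreover obtain i where "i < n" "w $ i \<noteq> 0" using w(1,2) by (metis eq_vecI carrier_vecD index_zero_vec)
  then have "N > 0" unfolding N_def by (intro sum_pos2[of _ i]) auto
  ultimately have "cnj z = z" using QN by (metis complex_cnj_complex_of_real complex_cnj_mult mult_cancel_right of_real_eq_0_iff order_less_irrefl)
  then obtain e where e: "z = of_real e" by (metis Reals_cnj_iff Reals_cases)
  have re: "(\<Sum>j<n. A $$ (i, j) * Re (w $ j)) = e * Re (w $ i)"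
    and im: "(\<Sum>j<n. A $$ (i, j) * Im (w $ j)) = e * Im (w $ i)" if "i < n" for i
    using arg_cong[OF Aw[OF that], of Re] arg_cong[OF Aw[OF that], of Im] by (simp_all add: e)
  show thesis
  proof (cases "Re (w $ i) = 0")
    case False
    show thesis
      by (rule that[of "vec n (\<lambda>i. Re (w $ i))" e])
        (use \<open>i < n\<close> False re A in \<open>auto simp: vec_eq_iff scalar_prod_def atLeast0LessThan\<close>)
  next
    case True
    with \<open>w $ i \<noteq> 0\<close> have "Im (w $ i) \<noteq> 0" by (simp add: complex_eq_iff)
    then show thesis
      by (intro that[of "vec n (\<lambda>i. Im (w $ i))" e])
        (use \<open>i < n\<close> im A in \<open>auto simp: vec_eq_iff scalar_prod_def atLeast0LessThan\<close>)
  qed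
qed

text \<open>Starts the induction step of the diagonalization: an orthogonal matrix whose first column is a
  multiple of a given vector, obtained by normalizing the output of Gram-Schmidt.\<close>

lemma orthonormal_completion:
  fixes v :: "real vec"
  assumes v: "v \<in> carrier_vec n" and v0: "v \<noteq> 0\<^sub>v n"
  obtains W c where "W \<in> carrier_mat n n" "transpose_mat W * W = 1\<^sub>m n" "col W 0 = c \<cdot>\<^sub>v v"
proof -
  interpret cof_vec_space n "TYPE(real)" .
  define b where "b = basis_completion v"
  note b = basis_completion[OF v v0, folded b_def]
  from v v0 have "n \<noteq> 0" by (auto simp: vec_eq_iff)
  with b obtain vs where bv: "b = v # vs" by (cases b) auto
  define ws where "ws = gram_schmidt n b"
  note ws = gram_schmidt_result[OF b(2) b(4) b(5) ws_def]
  have len: "length ws = n" using ws(4) b(6) by simp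
  have hd: "ws ! 0 = v" using gram_schmidt_hd[OF v, of vs] \<open>n \<noteq> 0\<close> len
    unfolding ws_def bv by (metis hd_conv_nth length_0_conv)
  have wsc: "ws ! i \<in> carrier_vec n" if "i < n" for i using ws(3) that len by auto
  have orth: "ws ! i \<bullet> ws ! j = 0 \<longleftrightarrow> i \<noteq> j" if "i < n" "j < n" for i j
    using corthogonalD[OF ws(2), of i j] that len by (simp add: scalar_prod_def)
  have pos: "ws ! i \<bullet> ws ! i > 0" if "i < n" for i
  proof -
    have "ws ! i \<bullet> ws ! i \<ge> 0" by (simp add: scalar_prod_def sum_nonneg)
    with orth[OF that that] show ?thesis by simp
  qed
  define W where "W = mat n n (\<lambda>(i, j). (1 / sqrt (ws ! j \<bullet> ws ! j)) * ws ! j $ i)"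
  have W: "W \<in> carrier_mat n n" by (simp add: W_def)
  have colW: "col W j = (1 / sqrt (ws ! j \<bullet> ws ! j)) \<cdot>\<^sub>v (ws ! j)" if "j < n" for j
    using wsc[OF that] that by (intro eq_vecI) (auto simp: W_def)
  have "transpose_mat W * W = 1\<^sub>m n"
  proof (rule eq_matI)
    fix i j assume "i < dim_row (1\<^sub>m n :: real mat)" "j < dim_col (1\<^sub>m n :: real mat)"
    then have ij: "i < n" "j < n" by auto
    have "(transpose_mat W * W) $$ (i, j) = col W i \<bullet> col W j" using W ij by simp
    also have "\<dots> = 1 / sqrt (ws ! i \<bullet> ws ! i) * (1 / sqrt (ws ! j \<bullet> ws ! j) * (ws ! i \<bullet> ws ! j))"
      using ij wsc[OF ij(1)] wsc[OF ij(2)] by (simp add: colW)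
    also have "\<dots> = 1\<^sub>m n $$ (i, j)"
      using ij orth[OF ij] pos[OF ij(1)] by (cases "i = j") (simp_all add: field_simps real_sqrt_mult_self)
    finally show "(transpose_mat W * W) $$ (i, j) = 1\<^sub>m n $$ (i, j)" .
  qed (use W in auto)
  with W that colW[of 0] hd \<open>n \<noteq> 0\<close> show thesis by auto
qed

text \<open>The spectral theorem, by deflation. Conjugating with an orthogonal matrix whose first column is an
  eigenvector keeps \<open>A\<close> symmetric and splits off a \<open>1 \<times> 1\<close> block, because a symmetric matrix whose first
  column vanishes below the diagonal also has a vanishing first row there.\<close>

lemma real_symmetric_diagonalization:
  fixes A :: "real mat"
  assumes "A \<in> carrier_mat n n" and "transpose_mat A = A"
  obtains P e where "P \<in> carrier_mat n n" "transpose_mat P * P = 1\<^sub>m n"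
    "A = P * mat_diag n e * transpose_mat P"
proof -
  have "\<exists>P e. P \<in> carrier_mat n n \<and> transpose_mat P * P = 1\<^sub>m n \<and> transpose_mat P * A * P = mat_diag n e"
    using assms
  proof (induction n arbitrary: A)
    case 0
    then show ?case by (intro exI[of _ "1\<^sub>m 0"] exI[of _ "\<lambda>_. 0"]) (auto intro!: eq_matI simp: mat_diag_def)
  next
    case (Suc k)
    let ?n = "Suc k"
    from real_symmetric_has_eigenvector[OF Suc.prems] obtain v e
      where v: "v \<in> carrier_vec ?n" "v \<noteq> 0\<^sub>v ?n" "A *\<^sub>v v = e \<cdot>\<^sub>v v" by auto
    from orthonormal_completion[OF v(1,2)] obtain W c
      where W: "W \<in> carrier_mat ?n ?n" "transpose_mat W * W = 1\<^sub>m ?n" "col W 0 = c \<cdot>\<^sub>v v" .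
    define T where "T = transpose_mat W * A * W"
    have T: "T \<in> carrier_mat ?n ?n" using W Suc.prems by (simp add: T_def)
    have symT: "transpose_mat T = T"
      unfolding T_def using W(1) Suc.prems
      by (simp add: transpose_mult[of _ ?n ?n _ ?n] assoc_mult_mat[of _ ?n ?n _ ?n _ ?n])
    have AW: "A * W \<in> carrier_mat ?n ?n" and Wt: "transpose_mat W \<in> carrier_mat ?n ?n"
      using W(1) Suc.prems(1) by auto
    have "T = transpose_mat W * (A * W)"
      unfolding T_def by (rule assoc_mult_mat[OF Wt Suc.prems(1) W(1)])
    then have "col T 0 = transpose_mat W *\<^sub>v (A *\<^sub>v col W 0)"
      using col_mult2[OF Wt AW] col_mult2[OF Suc.prems(1) W(1)] by simp
    also have "A *\<^sub>v col W 0 = e \<cdot>\<^sub>v col W 0"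
      unfolding W(3) using v(1,3) Suc.prems(1)
      by (simp add: mult_mat_vec[of _ ?n ?n] smult_smult_assoc mult.commute)
    also have "transpose_mat W *\<^sub>v (e \<cdot>\<^sub>v col W 0) = e \<cdot>\<^sub>v (transpose_mat W *\<^sub>v col W 0)"
      using W(1) by (intro mult_mat_vec[of _ ?n ?n]) (auto intro: col_carrier_vec)
    also have "transpose_mat W *\<^sub>v col W 0 = col (1\<^sub>m ?n) 0"
      unfolding W(2)[symmetric] using W(1) by (subst col_mult2[of _ ?n ?n _ ?n]) auto
    finally have colT: "col T 0 = e \<cdot>\<^sub>v unit_vec ?n 0" by simp
    have T0: "T $$ (i, 0) = (if i = 0 then e else 0)" if "i < ?n" for i
      using arg_cong[OF colT, of "\<lambda>u. u $ i"] that T by auto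
    have Tsym: "T $$ (i, j) = T $$ (j, i)" if "i < ?n" "j < ?n" for i j
      using arg_cong[OF symT, of "\<lambda>M. M $$ (i, j)"] that T by simp
    define A3 where "A3 = mat k k (\<lambda>(i, j). T $$ (Suc i, Suc j))"
    have A3: "A3 \<in> carrier_mat k k" by (simp add: A3_def)
    have "transpose_mat A3 = A3"
      by (rule eq_matI) (auto simp: A3_def intro: Tsym)
    from Suc.IH[OF A3 this] obtain P3 e3 where P3: "P3 \<in> carrier_mat k k"
      "transpose_mat P3 * P3 = 1\<^sub>m k" "transpose_mat P3 * A3 * P3 = mat_diag k e3" by auto
    have Tblock: "T = four_block_mat (mat 1 1 (\<lambda>_. e)) (0\<^sub>m 1 k) (0\<^sub>m k 1) A3"
      by (rule eq_matI) (use T in \<open>auto simp: A3_def T0 Tsym[of 0]\<close>)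
    define R where "R = four_block_mat (1\<^sub>m 1) (0\<^sub>m 1 k) (0\<^sub>m k 1) P3"
    have R: "R \<in> carrier_mat ?n ?n" unfolding R_def plus_1_eq_Suc[symmetric] using P3(1) by (intro four_block_carrier_mat) auto
    have Rt: "transpose_mat R = four_block_mat (1\<^sub>m 1) (0\<^sub>m 1 k) (0\<^sub>m k 1) (transpose_mat P3)"
      unfolding R_def using P3(1) by (subst transpose_four_block_mat[of _ 1 1 _ k _ k]) auto
    have RR: "transpose_mat R * R = 1\<^sub>m ?n"
    proof -
      have "transpose_mat R * R = four_block_mat (1\<^sub>m 1) (0\<^sub>m 1 k) (0\<^sub>m k 1) (1\<^sub>m k)"
        unfolding Rt unfolding R_def using P3 by (subst mult_four_block_mat[of _ 1 1 _ k _ k _ _ 1 _ k]) auto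
      then show ?thesis by (simp add: four_block_one_mat)
    qed
    have RTR: "transpose_mat R * T * R = mat_diag ?n (\<lambda>i. case i of 0 \<Rightarrow> e | Suc j \<Rightarrow> e3 j)"
    proof -
      have "transpose_mat R * T = four_block_mat (mat 1 1 (\<lambda>_. e)) (0\<^sub>m 1 k) (0\<^sub>m k 1) (transpose_mat P3 * A3)"
        unfolding Rt Tblock using P3(1) A3
        by (subst mult_four_block_mat[of _ 1 1 _ k _ k _ _ 1 _ k]) auto
      then have "transpose_mat R * T * R =
          four_block_mat (mat 1 1 (\<lambda>_. e)) (0\<^sub>m 1 k) (0\<^sub>m k 1) (mat_diag k e3)"
        unfolding P3(3)[symmetric] R_def using P3(1) A3
        by (simp) (subst mult_four_block_mat[of _ 1 1 _ k _ k _ _ 1 _ k]; auto)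
      also have "\<dots> = mat_diag ?n (\<lambda>i. case i of 0 \<Rightarrow> e | Suc j \<Rightarrow> e3 j)"
        by (rule eq_matI) (auto simp: mat_diag_def split: nat.split)
      finally show ?thesis .
    qed
    have "transpose_mat (W * R) * (W * R) = transpose_mat R * (transpose_mat W * W) * R"
      using W(1) R by (simp add: transpose_mult[of _ ?n ?n _ ?n] assoc_mult_mat[of _ ?n ?n _ ?n _ ?n])
    also have "\<dots> = 1\<^sub>m ?n" using W(2) RR R by simp
    finally have 1: "transpose_mat (W * R) * (W * R) = 1\<^sub>m ?n" .
    have "transpose_mat (W * R) * A * (W * R) = transpose_mat R * T * R"
      using W(1) R Suc.prems(1) unfolding T_def
      by (simp add: transpose_mult[of _ ?n ?n _ ?n] assoc_mult_mat[of _ ?n ?n _ ?n _ ?n])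
    with 1 RTR W(1) R show ?case by (intro exI[of _ "W * R"] exI[of _ "\<lambda>i. case i of 0 \<Rightarrow> e | Suc j \<Rightarrow> e3 j"]) simp
  qed
  then obtain P e where P: "P \<in> carrier_mat n n" "transpose_mat P * P = 1\<^sub>m n"
    and D: "transpose_mat P * A * P = mat_diag n e" by blast
  have PP: "P * transpose_mat P = 1\<^sub>m n"
    using mat_mult_left_right_inverse[of "transpose_mat P" n P] P by simp
  have "A = (P * transpose_mat P) * A * (P * transpose_mat P)" using PP assms(1) by simp
  also have "\<dots> = P * (transpose_mat P * A * P) * transpose_mat P"
    using P(1) assms(1) by (simp add: assoc_mult_mat[of _ n n _ n _ n])
  finally show thesis using that P unfolding D by blast
qed

lemma scalar_prod_self_eq_sum: "(v :: real vec) \<bullet> v = (\<Sum>i<dim_vec v. (v $ i)\<^sup>2)"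
  by (simp add: scalar_prod_def power2_eq_square atLeast0LessThan)

lemma similar_diag_proots_char_poly:
  fixes B P Q :: "real mat"
  assumes "P \<in> carrier_mat n n" "Q \<in> carrier_mat n n" "Q * P = 1\<^sub>m n" "B = P * mat_diag n e * Q"
  shows "proots (char_poly B) = mset (map e [0..<n])"
proof -
  let ?D = "mat_diag n e"
  have D: "?D \<in> carrier_mat n n" by simp
  have PQ: "P * Q = 1\<^sub>m n" using mat_mult_left_right_inverse[of Q n P] assms by simp
  have "B \<in> carrier_mat n n" unfolding assms(4) using assms(1,2) D by (intro mult_carrier_mat)
  then have "similar_mat_wit B ?D P Q"
    using assms by (intro similar_mat_witI[OF PQ assms(3,4)]) auto
  then have "similar_mat B ?D" unfolding similar_mat_def by blast
  then have "char_poly B = char_poly ?D" by (rule char_poly_similar)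
  also have "\<dots> = (\<Prod>a\<leftarrow>diag_mat ?D. [:- a, 1:])"
    by (rule char_poly_upper_triangular[OF D]) (auto simp: mat_diag_def)
  also have "diag_mat ?D = map e [0..<n]"
    by (simp add: diag_mat_def mat_diag_def)
  finally have cp: "char_poly B = (\<Prod>a\<leftarrow>map e [0..<n]. [:- a, 1:])" .
  have "proots (\<Prod>a\<leftarrow>xs. [:- a, 1:]) = mset xs" for xs :: "real list"
  proof (induction xs)
    case (Cons x xs)
    have "(\<Prod>a\<leftarrow>xs. [:- a, 1:]) \<noteq> 0" by (auto simp: prod_list_zero_iff)
    with Cons show ?case by (simp del: mult_pCons_left add: proots_mult)
  qed simp
  then show ?thesis unfolding cp .
qed

context
  fixes A :: "real mat" and n :: nat
  assumes A: "A \<in> carrier_mat n n" and sym: "transpose_mat A = A"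
begin

text \<open>The same eigenbasis diagonalizes \<open>r I - A\<close>.\<close>

lemma proots_char_poly_reflect:
  "proots (char_poly (r \<cdot>\<^sub>m 1\<^sub>m n - A)) = image_mset (\<lambda>\<mu>. r - \<mu>) (proots (char_poly A))"
proof -
  from real_symmetric_diagonalization[OF A sym] obtain P e where P: "P \<in> carrier_mat n n"
    "transpose_mat P * P = 1\<^sub>m n" and AP: "A = P * mat_diag n e * transpose_mat P" .
  have PP: "P * transpose_mat P = 1\<^sub>m n"
    using mat_mult_left_right_inverse[of "transpose_mat P" n P] P by simp
  have "mat_diag n (\<lambda>i. r - e i) = r \<cdot>\<^sub>m 1\<^sub>m n - mat_diag n e"
    by (rule eq_matI) (auto simp: mat_diag_def)
  then have "P * mat_diag n (\<lambda>i. r - e i) * transpose_mat P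
      = (P * (r \<cdot>\<^sub>m 1\<^sub>m n) - P * mat_diag n e) * transpose_mat P"
    using P(1) by (simp add: mult_minus_distrib_mat[of _ n n _ n])
  also have "\<dots> = P * (r \<cdot>\<^sub>m 1\<^sub>m n) * transpose_mat P - A"
    unfolding AP using P(1) by (intro minus_mult_distrib_mat[of _ n n _ _ n]) auto
  also have "P * (r \<cdot>\<^sub>m 1\<^sub>m n) * transpose_mat P = r \<cdot>\<^sub>m 1\<^sub>m n"
    using P(1) PP by (simp add: mult_smult_distrib[of _ n n _ n] mult_smult_assoc_mat[of _ n n _ n])
  finally have "r \<cdot>\<^sub>m 1\<^sub>m n - A = P * mat_diag n (\<lambda>i. r - e i) * transpose_mat P" by simp
  from similar_diag_proots_char_poly[OF P(1) _ P(2) this] similar_diag_proots_char_poly[OF P(1) _ P(2) AP]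
  show ?thesis using P(1) by (simp add: image_mset.compositionality comp_def)
qed

text \<open>The three consequences of the spectral theorem used below: all roots of the characteristic polynomial
  are real, they add up to the trace, and the largest one is the maximum of the Rayleigh quotient.\<close>

lemma symmetric_spectrum:
  shows symmetric_size_spectrum: "size (proots (char_poly A)) = n"
    and symmetric_trace: "sum_mset (proots (char_poly A)) = (\<Sum>i<n. A $$ (i, i))"
    and symmetric_eigenvalues_le_iff:
      "(\<forall>\<mu>\<in>#proots (char_poly A). \<mu> \<le> m) \<longleftrightarrow> (\<forall>s\<in>carrier_vec n. s \<bullet> (A *\<^sub>v s) \<le> m * (s \<bullet> s))"
proof -
  from real_symmetric_diagonalization[OF A sym] obtain P e where P: "P \<in> carrier_mat n n"
    "transpose_mat P * P = 1\<^sub>m n" and AP: "A = P * mat_diag n e * transpose_mat P" .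
  have PP: "P * transpose_mat P = 1\<^sub>m n"
    using mat_mult_left_right_inverse[of "transpose_mat P" n P] P by simp
  have spec: "proots (char_poly A) = mset (map e [0..<n])"
    by (rule similar_diag_proots_char_poly[OF P(1) _ P(2) AP]) (use P in simp)
  then show "size (proots (char_poly A)) = n" by simp
  have APi: "A $$ (i, i) = (\<Sum>k<n. e k * (P $$ (i, k))\<^sup>2)" if "i < n" for i
  proof -
    have "(P * mat_diag n e) $$ (i, k) = e k * P $$ (i, k)" if "k < n" for k
      using P(1) that \<open>i < n\<close> by (simp add: mat_diag_mult_right[of _ n n] mult.commute)
    then have "row (P * mat_diag n e) i $ k = e k * P $$ (i, k)" if "k < n" for k
      using P(1) that \<open>i < n\<close> by (subst index_row) (auto simp: mat_diag_def)
    then show ?thesis unfolding AP using P(1) \<open>i < n\<close>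
      by (subst index_mult_mat(1))
        (auto simp: scalar_prod_def power2_eq_square atLeast0LessThan mult.assoc simp del: index_mult_mat(1)
          intro!: sum.cong)
  qed
  have nrm: "(\<Sum>i<n. (P $$ (i, k))\<^sup>2) = 1" if "k < n" for k
    using arg_cong[OF P(2), of "\<lambda>M. M $$ (k, k)"] P(1) that
    by (simp add: scalar_prod_def power2_eq_square atLeast0LessThan)
  have "(\<Sum>i<n. A $$ (i, i)) = (\<Sum>k<n. \<Sum>i<n. e k * (P $$ (i, k))\<^sup>2)"
    by (simp add: APi) (rule sum.swap)
  also have "\<dots> = (\<Sum>k<n. e k)" by (simp add: sum_distrib_left[symmetric] nrm)
  finally show "sum_mset (proots (char_poly A)) = (\<Sum>i<n. A $$ (i, i))"
    unfolding spec sum_mset_sum_list by (simp add: interv_sum_list_conv_sum_set_nat atLeast0LessThan del: mset_map)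
  show "(\<forall>\<mu>\<in>#proots (char_poly A). \<mu> \<le> m) \<longleftrightarrow> (\<forall>s\<in>carrier_vec n. s \<bullet> (A *\<^sub>v s) \<le> m * (s \<bullet> s))"
  proof (intro iffI ballI)
    fix s :: "real vec" assume le: "\<forall>\<mu>\<in>#proots (char_poly A). \<mu> \<le> m" and s: "s \<in> carrier_vec n"
    define w where "w = transpose_mat P *\<^sub>v s"
    have w: "w \<in> carrier_vec n" using P(1) s unfolding w_def by (intro mult_mat_vec_carrier) auto
    have sw: "s = P *\<^sub>v w"
      unfolding w_def using P(1) s PP by (simp add: assoc_mult_mat_vec[of _ n n _ n, symmetric])
    have ss: "s \<bullet> (P *\<^sub>v u) = w \<bullet> u" if "u \<in> carrier_vec n" for u
      unfolding w_def using transpose_vec_mult_scalar[of P n n u s] P(1) s that 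
      by (metis comm_scalar_prod mult_mat_vec_carrier transpose_carrier_mat)
    have "A *\<^sub>v s = P *\<^sub>v (mat_diag n e *\<^sub>v w)"
      unfolding AP w_def using P(1) s by (simp add: assoc_mult_mat_vec[of _ n n _ n])
    then have "s \<bullet> (A *\<^sub>v s) = w \<bullet> (mat_diag n e *\<^sub>v w)"
      using ss[of "mat_diag n e *\<^sub>v w"] w by (metis mat_diag_dim mult_mat_vec_carrier)
    also have "\<dots> = (\<Sum>i<n. e i * (w $ i)\<^sup>2)"
    proof -
      have "(mat_diag n e *\<^sub>v w) $ i = e i * w $ i" if "i < n" for i
      proof -
        have "(mat_diag n e *\<^sub>v w) $ i = (\<Sum>j<n. (if i = j then e j else 0) * w $ j)"
          using w that by (simp add: scalar_prod_def mat_diag_def atLeast0LessThan)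
        also have "\<dots> = (\<Sum>j<n. if i = j then e j * w $ j else 0)" by (intro sum.cong) auto
        finally show ?thesis using that by simp
      qed
      then show ?thesis using w
        by (simp add: scalar_prod_def[of w] power2_eq_square atLeast0LessThan mat_diag_def mult_ac)
    qed
    also have "\<dots> \<le> (\<Sum>i<n. m * (w $ i)\<^sup>2)"
      using le by (intro sum_mono mult_right_mono) (auto simp: spec)
    also have "\<dots> = m * (w \<bullet> w)" using w by (simp add: scalar_prod_self_eq_sum sum_distrib_left)
    also have "w \<bullet> w = s \<bullet> s" using ss[OF w] sw by simp
    finally show "s \<bullet> (A *\<^sub>v s) \<le> m * (s \<bullet> s)" .
  next
    fix \<mu> assume le: "\<forall>s\<in>carrier_vec n. s \<bullet> (A *\<^sub>v s) \<le> m * (s \<bullet> s)" and "\<mu> \<in># proots (char_poly A)"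
    then have "eigenvalue A \<mu>"
      using char_poly_nonzero[OF A] by (simp add: eigenvalue_root_char_poly[OF A])
    then obtain s where s: "s \<in> carrier_vec n" "s \<noteq> 0\<^sub>v n" "A *\<^sub>v s = \<mu> \<cdot>\<^sub>v s"
      unfolding eigenvalue_def eigenvector_def using A by auto
    then obtain i where "i < n" "s $ i \<noteq> 0" by (metis eq_vecI carrier_vecD index_zero_vec)
    then have "s \<bullet> s > 0"
      unfolding scalar_prod_self_eq_sum using s(1) by (intro sum_pos2[of _ i]) auto
    moreover have "\<mu> * (s \<bullet> s) \<le> m * (s \<bullet> s)" using le s by (metis scalar_prod_smult_right carrier_vecD)
    ultimately show "\<mu> \<le> m" by simp
  qed
qed

end

text \<open>If \<open>n - 1\<close> of the \<open>n\<close> columns are linearly independent, then a kernel vector that vanishes at the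
  remaining index \<open>j0\<close> is a linear relation between independent columns, hence zero. Subtracting a
  multiple of \<open>x\<close> from \<open>y\<close> produces such a vector.\<close>

lemma kernel_proportional_if_rank_pred:
  fixes A :: "'a::field mat"
  assumes A: "A \<in> carrier_mat n n" and rank: "vec_space.rank n A = n - 1"
    and x: "x \<in> carrier_vec n" "A *\<^sub>v x = 0\<^sub>v n" "x \<noteq> 0\<^sub>v n"
    and y: "y \<in> carrier_vec n" "A *\<^sub>v y = 0\<^sub>v n"
  obtains c where "y = c \<cdot>\<^sub>v x"
proof -
  interpret vec_space "TYPE('a)" n .
  have "n > 0" using x by (auto simp: vec_eq_iff)
  have colsA: "set (cols A) = col A ` {..<n}" using A by (auto simp: cols_def)
  obtain S where S: "maximal S (\<lambda>T. T \<subseteq> set (cols A) \<and> lin_indpt T)"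
    using maximal_exists_superset[of "set (cols A)" "\<lambda>T. T \<subseteq> set (cols A) \<and> lin_indpt T" "{}"]
    by (auto simp: lin_dep_def)
  then have Ssub: "S \<subseteq> col A ` {..<n}" and ind: "lin_indpt S" unfolding maximal_def colsA by auto
  obtain I where I: "I \<subseteq> {..<n}" "inj_on (col A) I" "S = col A ` I"
    using subset_image_inj[THEN iffD1, OF Ssub] by auto
  have "card I = n - 1" using rank rank_card_indpt[OF A S] I by (simp add: card_image)
  then have "card ({..<n} - I) = 1" using I(1) \<open>n > 0\<close> by (subst card_Diff_subset) (auto intro: finite_subset)
  then obtain j0 where j0: "{..<n} - I = {j0}" by (rule card_1_singletonE)
  then have nI: "{..<n} = insert j0 I" "j0 \<notin> I" "j0 < n" using I(1) by auto
  have finI: "finite I" using I(1) by (rule finite_subset) simp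
  have zero: "z = 0\<^sub>v n" if z: "z \<in> carrier_vec n" "A *\<^sub>v z = 0\<^sub>v n" "z $ j0 = 0" for z
  proof (rule ccontr)
    assume "z \<noteq> 0\<^sub>v n"
    then obtain j where j: "j < n" "z $ j \<noteq> 0" using z(1) by (metis eq_vecI carrier_vecD index_zero_vec)
    with z(3) nI have "j \<in> I" by (metis insert_iff lessThan_iff)
    define a where "a w = z $ the_inv_into I (col A) w" for w
    have a: "a (col A i) = z $ i" if "i \<in> I" for i
      unfolding a_def using the_inv_into_f_f[OF I(2) that] by simp
    have Sc: "S \<subseteq> carrier_vec n" using I A by auto
    have "lincomb a S = 0\<^sub>v n"
    proof (rule eq_vecI)
      fix i assume "i < dim_vec (0\<^sub>v n :: 'a vec)"
      then have i: "i < n" by simp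
      have "lincomb a S $ i = (\<Sum>w\<in>S. a w * w $ i)" by (rule lincomb_index[OF i Sc])
      also have "\<dots> = (\<Sum>j\<in>I. z $ j * A $$ (i, j))"
        unfolding I(3) using I i A by (subst sum.reindex) (auto simp: a intro!: sum.cong)
      also have "\<dots> = (\<Sum>j<n. z $ j * A $$ (i, j))" unfolding nI(1) using finI nI(2) z(3) by simp
      also have "\<dots> = (A *\<^sub>v z) $ i"
        using A z(1) i by (simp add: scalar_prod_def atLeast0LessThan mult.commute)
      finally show "lincomb a S $ i = 0\<^sub>v n $ i" using z(2) by simp
    qed (use lincomb_dim[of S a] Sc finI I(3) in auto)
    moreover have "a (col A j) \<noteq> 0" "col A j \<in> S" using \<open>j \<in> I\<close> j a I(3) by auto
    ultimately have "lin_dep S" unfolding lin_dep_def using finI I(3)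
      by (intro exI[of _ S] exI[of _ a] exI[of _ "col A j"]) auto
    with ind show False by simp
  qed
  have xj: "x $ j0 \<noteq> 0" using zero[OF x(1,2)] x(3) by blast
  define c where "c = y $ j0 / x $ j0"
  have "A *\<^sub>v (y - c \<cdot>\<^sub>v x) = 0\<^sub>v n"
    using A x y by (simp add: mult_minus_distrib_mat_vec[of _ n n] mult_mat_vec[of _ n n])
  from zero[OF _ this] have d0: "y - c \<cdot>\<^sub>v x = 0\<^sub>v n" using x y xj nI(3) by (simp add: c_def)
  have "y = c \<cdot>\<^sub>v x"
  proof (rule eq_vecI)
    fix i assume "i < dim_vec (c \<cdot>\<^sub>v x)"
    then show "y $ i = (c \<cdot>\<^sub>v x) $ i" using arg_cong[OF d0, of "\<lambda>u. u $ i"] x y by simp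
  qed (use x y in simp)
  then show thesis by (rule that)
qed

text \<open>Translates connectedness, which is a condition on the rank, into a condition on the multiplicity of
  the root \<open>0\<close>: two zero diagonal entries in the spectral decomposition would give two orthogonal
  kernel vectors.\<close>

lemma count_zero_le_1_if_symmetric_rank_pred:
  fixes A :: "real mat"
  assumes A: "A \<in> carrier_mat n n" and sym: "transpose_mat A = A" and rank: "vec_space.rank n A = n - 1"
  shows "count (proots (char_poly A)) 0 \<le> 1"
proof (rule ccontr)
  assume "\<not> ?thesis"
  from real_symmetric_diagonalization[OF A sym] obtain P e where P: "P \<in> carrier_mat n n"
    "transpose_mat P * P = 1\<^sub>m n" and AP: "A = P * mat_diag n e * transpose_mat P" .
  have "proots (char_poly A) = mset (map e [0..<n])"
    by (rule similar_diag_proots_char_poly[OF P(1) _ P(2) AP]) (use P in simp)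
  moreover have "count (mset (map e [0..<n])) 0 = card {i. i < n \<and> e i = 0}"
    unfolding count_mset count_list_eq_length_filter length_filter_conv_card
    by (rule arg_cong[of _ _ card]) auto
  ultimately have "card {i. i < n \<and> e i = 0} > 1"
    using \<open>\<not> count (proots (char_poly A)) 0 \<le> 1\<close> by simp
  moreover have "finite {i. i < n \<and> e i = 0}" by simp
  ultimately obtain i j where ij: "i < n" "e i = 0" "j < n" "e j = 0" "i \<noteq> j"
    using card_le_Suc0_iff_eq[of "{i. i < n \<and> e i = 0}"] by auto
  have "A * P = P * mat_diag n e * (transpose_mat P * P)"
    unfolding AP using P(1) by (intro assoc_mult_mat[of _ n n _ n _ n]) (auto intro!: mult_carrier_mat[of _ n n])
  also have "\<dots> = P * mat_diag n e"
    unfolding P(2) using P(1) by (intro right_mult_one_mat[of _ n n] mult_carrier_mat[of _ n n]) auto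
  finally have "A * P = P * mat_diag n e" .
  then have ker: "A *\<^sub>v col P l = 0\<^sub>v n" if "l < n" "e l = 0" for l
    unfolding col_mult2[OF A P(1) that(1), symmetric] using P(1) that
    by (intro eq_vecI) (auto simp: mat_diag_mult_right[OF P(1)])
  have pp: "col P l \<bullet> col P l' = (if l = l' then 1 else 0)" if "l < n" "l' < n" for l l'
    using arg_cong[OF P(2), of "\<lambda>M. M $$ (l, l')"] P(1) that by simp
  have c: "col P l \<in> carrier_vec n" for l using P(1) by auto
  have "col P i \<noteq> 0\<^sub>v n" using pp[of i i] ij(1) by auto
  from kernel_proportional_if_rank_pred[OF A rank c ker[OF ij(1,2)] this c ker[OF ij(3,4)]]
  obtain a where a: "col P j = a \<cdot>\<^sub>v col P i" .
  have "a = col P i \<bullet> col P j" unfolding a using pp[of i i] ij(1) c[of i] by simp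
  also have "\<dots> = 0" using pp ij by simp
  finally have "col P j \<bullet> col P j = 0" unfolding a using c[of i] by simp
  with pp[of j j] ij(3) show False by simp
qed

section \<open>Convex sums over multisets\<close>

text \<open>Jensen's inequality with equal weights.\<close>

lemma convex_on_mean_mset:
  fixes f :: "real \<Rightarrow> real"
  assumes f: "convex_on S f" and M: "set_mset M \<subseteq> S" "M \<noteq> {#}"
  shows "real (size M) * f (sum_mset M / real (size M)) \<le> (\<Sum>x\<in>#M. f x)"
proof -
  obtain xs where xs: "mset xs = M" using ex_mset by blast
  let ?n = "length xs"
  have n: "?n > 0" "size M = ?n" using M(2) xs by auto
  have "f (\<Sum>i<?n. (1 / real ?n) *\<^sub>R xs ! i) \<le> (\<Sum>i<?n. 1 / real ?n * f (xs ! i))"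
  proof (rule convex_on_sum[OF _ _ f])
    fix i assume "i \<in> {..<?n}"
    then have "xs ! i \<in># M" using xs by (auto simp: in_multiset_in_set)
    then show "xs ! i \<in> S" using M(1) by blast
  qed (use n in auto)
  moreover have "(\<Sum>i<?n. (1 / real ?n) *\<^sub>R xs ! i) = sum_mset M / real ?n"
    unfolding xs[symmetric] sum_mset_sum_list sum_list_sum_nth
    by (simp add: sum_divide_distrib atLeast0LessThan)
  moreover have "(\<Sum>i<?n. 1 / real ?n * f (xs ! i)) = (\<Sum>x\<in>#M. f x) / real ?n"
    unfolding xs[symmetric] mset_map[symmetric] sum_mset_sum_list sum_list_sum_nth
    by (simp add: sum_divide_distrib atLeast0LessThan)
  ultimately show ?thesis using n by (simp add: field_simps)
qed

lemma sum_mset_diff_const: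
  "sum_mset (image_mset (\<lambda>x. a - x) M) = real (size M) * a - sum_mset M" for a :: real
  by (induction M) (auto simp: algebra_simps)

text \<open>One point of weight \<open>1\<close> and one of weight \<open>N\<close>, with a fixed weighted sum: moving them apart cannot decrease
  the weighted sum of the values. Both \<open>a\<close> and \<open>b\<close> lie between \<open>x\<close> and \<open>y\<close>, and the coefficients of the
  two convex combinations add up to the weights of \<open>x\<close> and \<open>y\<close>.\<close>

lemma convex_on_spread_two_level:
  fixes f :: "real \<Rightarrow> real"
  assumes f: "convex_on S f" and x: "x \<in> S" and y: "y \<in> S"
    and le: "x \<le> a" "a \<le> b" and N: "N \<ge> 0" and eq: "x + N * y = a + N * b"
  shows "f a + N * f b \<le> f x + N * f y"
proof (cases "x = a")
  case True
  then show ?thesis using eq by (cases "N = 0") auto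
next
  case False
  with le eq have N0: "N > 0" using N by (cases "N = 0") auto
  have "N * b < N * y" using False le eq by linarith
  then have "b < y" using N0 by simp
  then have xy: "x < y" using le by simp
  define t where "t = (y - a) / (y - x)"
  define u where "u = (y - b) / (y - x)"
  have "t * (y - x) = y - a" "u * (y - x) = y - b" using xy by (simp_all add: t_def u_def)
  then have tu: "a = t * x + (1 - t) * y" "b = u * x + (1 - u) * y" by (simp_all add: algebra_simps)
  have tu01: "0 \<le> t" "t \<le> 1" "0 \<le> u" "u \<le> 1" using xy le \<open>b < y\<close> by (simp_all add: t_def u_def)
  have "t + N * u = ((y - a) + N * (y - b)) / (y - x)" by (simp add: t_def u_def add_divide_distrib)
  also have "(y - a) + N * (y - b) = y - x" using eq by (simp add: algebra_simps)
  finally have "t + N * u = 1" using xy by simp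
  have "f a \<le> t * f x + (1 - t) * f y"
    using f x y tu01 unfolding tu(1) by (auto simp: convex_on_def)
  moreover have "N * f b \<le> N * (u * f x + (1 - u) * f y)"
    using f x y tu01 N unfolding tu(2) by (intro mult_left_mono) (auto simp: convex_on_def)
  ultimately have "f a + N * f b \<le> (t + N * u) * f x + (1 + N - (t + N * u)) * f y"
    by (simp add: algebra_simps)
  then show ?thesis unfolding \<open>t + N * u = 1\<close> by simp
qed

text \<open>Karamata's inequality in the case where all entries of the majorized vector other than its smallest
  one coincide. Replacing the elements other than \<open>z\<close> by their mean reduces the claim to two
  points.\<close>

lemma two_level_mset_minimizes_convex_sum:
  fixes f :: "real \<Rightarrow> real"
  assumes f: "convex_on S f" and M: "set_mset M \<subseteq> S" "size M = Suc N" "N > 0"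
    and S: "convex S" and sum: "sum_mset M = a + real N * b"
    and z: "z \<in># M" "z \<le> a" and "a \<le> b"
  shows "f a + real N * f b \<le> (\<Sum>x\<in>#M. f x)"
proof -
  obtain M' where M': "M = add_mset z M'" using z(1) by (metis multi_member_split)
  have sz: "size M' = N" using M(2) M' by simp
  with M(3) have "M' \<noteq> {#}" by auto
  define y where "y = sum_mset M' / real N"
  have eq: "z + real N * y = a + real N * b" 
  proof -
    have q: "real N * (q / real N) = q" for q :: real using M(3) by simp
    have "real N * y = sum_mset M'" unfolding y_def by (rule q)
    then show ?thesis using sum M' by simp
  qed
  have mean: "real N * f y \<le> (\<Sum>x\<in>#M'. f x)"
    using convex_on_mean_mset[OF f, of M'] M(1) M' \<open>M' \<noteq> {#}\<close> sz by (simp add: y_def)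
  have "y \<in> S"
  proof -
    obtain xs where xs: "mset xs = M'" using ex_mset by blast
    have "(\<Sum>i<N. (1 / real N) *\<^sub>R xs ! i) \<in> S"
    proof (rule convex_sum[OF _ S])
      fix i assume "i \<in> {..<N}"
      then have "xs ! i \<in># M'" using xs sz by (auto simp: in_multiset_in_set)
      then show "xs ! i \<in> S" using M(1) M' by auto
    qed (use M(3) in auto)
    moreover have "(\<Sum>i<N. (1 / real N) *\<^sub>R xs ! i) = y"
      unfolding y_def xs[symmetric] sum_mset_sum_list sum_list_sum_nth using sz xs
      by (auto simp: sum_divide_distrib atLeast0LessThan)
    ultimately show ?thesis by simp
  qed
  then have "f a + real N * f b \<le> f z + real N * f y"
    using convex_on_spread_two_level[OF f _ _ z(2) \<open>a \<le> b\<close> _ eq] M(1) z(1) by auto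
  with mean M' show ?thesis by simp
qed

section \<open>Spectrum of the information matrix\<close>

text \<open>Column \<open>h\<close> is the unit contrast of replicate \<open>h\<close>, the unique vector up to sign in the span of the
  indicators of its two blocks that has norm one and is orthogonal to the constants.\<close>

definition contrast_mat :: "nat \<Rightarrow> nat \<Rightarrow> nat \<Rightarrow> design \<Rightarrow> real mat" where
  "contrast_mat r k1 k2 d = mat (k1 + k2) r (\<lambda>(i, h).
     (real (k1 + k2) * of_bool (i \<in> fst (d h)) - real k1) / sqrt (real k1 * real k2 * real (k1 + k2)))"

definition gram_mat :: "nat \<Rightarrow> nat \<Rightarrow> nat \<Rightarrow> design \<Rightarrow> real mat" where
  "gram_mat r k1 k2 d = transpose_mat (contrast_mat r k1 k2 d) * contrast_mat r k1 k2 d"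

text \<open>The factor \<open>c\<close> by which a unit increase of a concurrence changes an entry of the Gram matrix.\<close>

definition gram_scale :: "nat \<Rightarrow> nat \<Rightarrow> real" where
  "gram_scale k1 k2 = real (k1 + k2) / (real k1 * real k2)"

text \<open>The contrasts together with a multiple of the constant vector (column \<open>0\<close>), scaled so that
  \<open>C = r I - Y Y'\<close>.\<close>

definition augmented_contrast_mat :: "nat \<Rightarrow> nat \<Rightarrow> nat \<Rightarrow> design \<Rightarrow> real mat" where
  "augmented_contrast_mat r k1 k2 d = mat (k1 + k2) (Suc r) (\<lambda>(i, j).
     case j of 0 \<Rightarrow> sqrt (real r / real (k1 + k2)) | Suc h \<Rightarrow> contrast_mat r k1 k2 d $$ (i, h))"

lemma sum_even_odd: "(\<Sum>j<2 * r. f j) = (\<Sum>h<r. f (2 * h) + f (Suc (2 * h)))"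
  for f :: "nat \<Rightarrow> 'a::comm_monoid_add"
  by (induction r) (simp_all add: add.assoc)

text \<open>An entry of the projection onto the span of the indicators of two complementary blocks of sizes \<open>x\<close>
  and \<open>y\<close>; \<open>a\<close> and \<open>b\<close> are the values at two treatments of the indicator of the first block.\<close>

lemma block_projection_entry:
  fixes x y a b :: real
  assumes "x > 0" "y > 0"
  shows "a * b / x + (1 - a) * (1 - b) / y
    = 1 / (x + y) + ((x + y) * a - x) * ((x + y) * b - x) / (x * y * (x + y))"
proof -
  have "x + y \<noteq> 0" using assms by simp
  then have "((x + y) * a - x) * ((x + y) * b - x) / (x * y * (x + y))
      = ((x + y) * (a * b) - x * a - x * b) / (x * y) + x / (y * (x + y))"
    using assms by (simp add: divide_simps) (simp add: algebra_simps)
  moreover have "1 / (x + y) + x / (y * (x + y)) = 1 / y"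
    using assms \<open>x + y \<noteq> 0\<close> by (simp add: divide_simps)
  moreover have "((x + y) * (a * b) - x * a - x * b) / (x * y) = a * b / y + a * b / x - a / y - b / y"
    using assms by (simp add: divide_simps) (simp add: algebra_simps)
  moreover have "(1 - a) * (1 - b) / y = 1 / y - a / y - b / y + a * b / y"
    by (simp add: algebra_simps add_divide_distrib diff_divide_distrib)
  ultimately show ?thesis by simp
qed

locale resolvable =
  fixes r k1 k2 :: nat and d :: design
  assumes k1: "k1 > 0" and k2: "k2 > 0" and d: "d \<in> resolvable_designs r k1 k2"
begin

abbreviation "v \<equiv> k1 + k2"
abbreviation "X \<equiv> contrast_mat r k1 k2 d"
abbreviation "Y \<equiv> augmented_contrast_mat r k1 k2 d"
abbreviation "G \<equiv> gram_mat r k1 k2 d"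
abbreviation "C \<equiv> information_mat r k1 k2 d"

lemma X_carrier [simp]: "X \<in> carrier_mat v r"
  and Y_carrier [simp]: "Y \<in> carrier_mat v (Suc r)"
  and G_carrier [simp]: "G \<in> carrier_mat r r"
  by (auto simp: contrast_mat_def augmented_contrast_mat_def gram_mat_def)

lemma C_carrier [simp]: "C \<in> carrier_mat v v"
  unfolding information_mat_def incidence_mat_def
  by (intro minus_carrier_mat mult_carrier_mat[of _ v "2 * r"])
    (auto simp: mat_inverse_block_size_mat k1 k2 intro!: mult_carrier_mat[of _ v "2 * r"])

lemma G_sym: "transpose_mat G = G"
  unfolding gram_mat_def by (simp add: transpose_mult[of _ r v _ r])

lemma block_facts:
  assumes "h < r"
  shows "fst (d h) \<subseteq> {..<v}" "snd (d h) = {..<v} - fst (d h)" "card (fst (d h)) = k1"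
proof -
  have "d h \<in> replicates k1 k2" using d assms by (auto simp: resolvable_designs_def)
  then have "fst (d h) \<union> snd (d h) = {..<v}" "fst (d h) \<inter> snd (d h) = {}" "card (fst (d h)) = k1"
    by (auto simp: replicates_def)
  then show "fst (d h) \<subseteq> {..<v}" "snd (d h) = {..<v} - fst (d h)" "card (fst (d h)) = k1" by auto
qed

lemma sum_of_bool_subset: "B \<subseteq> {..<v} \<Longrightarrow> (\<Sum>i<v. of_bool (i \<in> B)) = real (card B)"
  by (simp add: of_bool_def sum.If_cases Int_absorb1 del: of_nat_add)

lemma G_entry:
  assumes "h < r" "h' < r"
  shows "G $$ (h, h') = (real v * real (concurrence d h h') - (real k1)\<^sup>2) / (real k1 * real k2)"
proof -
  let ?a = "\<lambda>i. of_bool (i \<in> fst (d h)) :: real" and ?b = "\<lambda>i. of_bool (i \<in> fst (d h')) :: real"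
  let ?q = "real k1 * real k2 * real v"
  have sums: "(\<Sum>i<v. ?a i) = k1" "(\<Sum>i<v. ?b i) = k1" "(\<Sum>i<v. ?a i * ?b i) = concurrence d h h'"
    using block_facts[OF assms(1)] block_facts[OF assms(2)]
      sum_of_bool_subset[of "fst (d h)"] sum_of_bool_subset[of "fst (d h')"]
      sum_of_bool_subset[of "fst (d h) \<inter> fst (d h')"]
    by (auto simp: concurrence_def of_bool_conj)
  have "G $$ (h, h') = (\<Sum>i<v. X $$ (i, h) * X $$ (i, h'))"
    unfolding gram_mat_def using assms X_carrier
    by (simp add: scalar_prod_def atLeast0LessThan del: X_carrier)
  also have "\<dots> = (\<Sum>i<v. (real v * ?a i - k1) * (real v * ?b i - k1)) / ?q"
    unfolding sum_divide_distrib using assms k1 k2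
    by (intro sum.cong) (auto simp: contrast_mat_def)
  also have "(\<Sum>i<v. (real v * ?a i - k1) * (real v * ?b i - k1))
      = (\<Sum>i<v. (real v)\<^sup>2 * (?a i * ?b i) - real v * k1 * ?a i - real v * k1 * ?b i + (real k1)\<^sup>2)"
    by (intro sum.cong) (auto simp: algebra_simps power2_eq_square)
  also have "\<dots> = (real v)\<^sup>2 * concurrence d h h' - real v * k1 * k1 - real v * k1 * k1 + real v * (real k1)\<^sup>2"
    unfolding sum.distrib sum_subtractf sum_distrib_left[symmetric] sums by simp
  also have "\<dots> = real v * (real v * concurrence d h h' - (real k1)\<^sup>2)"
    by (simp add: algebra_simps power2_eq_square)
  finally show ?thesis using k1 by (simp del: of_nat_add add: of_nat_add[symmetric])
qed

lemma G_diag: "h < r \<Longrightarrow> G $$ (h, h) = 1"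
  using k1 k2 block_facts[of h]
  by (simp add: G_entry concurrence_def power2_eq_square field_simps)

lemma G_offdiag:
  assumes "h < r" "h' < r"
  shows "G $$ (h, h') = gram_scale k1 k2
    * (real (concurrence d h h') - real (theta_bar k1 k2) - gamma k1 k2)"
  unfolding G_entry[OF assms] gamma_def gram_scale_def using k1 k2
  by (simp add: field_simps del: of_nat_add)

lemma sum_X_col: assumes "h < r" shows "(\<Sum>i<v. X $$ (i, h)) = 0"
proof -
  have "(\<Sum>i<v. X $$ (i, h)) = (\<Sum>i<v. real v * of_bool (i \<in> fst (d h)) - real k1)
      / sqrt (real k1 * real k2 * real v)"
    unfolding sum_divide_distrib using assms by (intro sum.cong) (auto simp: contrast_mat_def)
  also have "(\<Sum>i<v. real v * of_bool (i \<in> fst (d h)) - real k1) = 0"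
    unfolding sum_subtractf sum_distrib_left[symmetric]
    using sum_of_bool_subset[OF block_facts(1)[OF assms]] block_facts(3)[OF assms] by simp
  finally show ?thesis by simp
qed

text \<open>Replicate by replicate, the entries are those of a block projection (\<open>block_projection_entry\<close>); the
  \<open>r\<close> copies of \<open>J/v\<close> add up to the contribution of the constant column.\<close>

lemma C_eq: "C = real r \<cdot>\<^sub>m 1\<^sub>m v - Y * transpose_mat Y"
proof -
  let ?N = "incidence_mat r k1 k2 d" and ?e = "\<lambda>j. if even j then 1 / real k1 else 1 / real k2"
  have N: "?N \<in> carrier_mat v (2 * r)" by (simp add: incidence_mat_def)
  have E: "the (mat_inverse (block_size_mat r k1 k2)) = mat_diag (2 * r) ?e"
    by (simp add: mat_inverse_block_size_mat k1 k2)
  have "?N * mat_diag (2 * r) ?e * transpose_mat ?N = Y * transpose_mat Y"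
  proof (rule eq_matI)
    fix i j assume "i < dim_row (Y * transpose_mat Y)" "j < dim_col (Y * transpose_mat Y)"
    then have ij: "i < v" "j < v" using carrier_matD[OF Y_carrier] by auto
    let ?a = "\<lambda>i h. of_bool (i \<in> fst (d h)) :: real"
    have "(?N * mat_diag (2 * r) ?e * transpose_mat ?N) $$ (i, j)
        = (\<Sum>l<2 * r. ?e l * of_bool (i \<in> block d l) * of_bool (j \<in> block d l))"
      using ij N unfolding mat_diag_mult_right[OF N]
      by (simp add: scalar_prod_def atLeast0LessThan incidence_mat_def del: sum_mult_of_bool_eq sum_of_bool_mult_eq)
        (intro sum.cong refl, simp add: of_bool_def)
    also have "\<dots> = (\<Sum>h<r. ?a i h * ?a j h / k1 + (1 - ?a i h) * (1 - ?a j h) / k2)"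
      unfolding sum_even_odd using ij
      by (intro sum.cong refl) (simp add: block_def block_facts(2))
    also have "\<dots> = (\<Sum>h<r. 1 / real v + X $$ (i, h) * X $$ (j, h))"
    proof (intro sum.cong refl)
      fix h assume "h \<in> {..<r}"
      then have "X $$ (i, h) * X $$ (j, h)
          = (real v * ?a i h - k1) * (real v * ?a j h - k1) / (real k1 * real k2 * real v)"
        using ij k1 k2 by (auto simp: contrast_mat_def)
      then show "?a i h * ?a j h / k1 + (1 - ?a i h) * (1 - ?a j h) / k2
          = 1 / real v + X $$ (i, h) * X $$ (j, h)"
        using block_projection_entry[of k1 k2 "?a i h" "?a j h"] k1 k2 by simp
    qed
    also have "\<dots> = sqrt (r / real v) * sqrt (r / real v) + (\<Sum>h<r. X $$ (i, h) * X $$ (j, h))"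
      by (simp add: sum.distrib)
    also have "\<dots> = (\<Sum>l<Suc r. Y $$ (i, l) * Y $$ (j, l))"
      unfolding sum.lessThan_Suc_shift using ij by (simp add: augmented_contrast_mat_def)
    also have "\<dots> = (Y * transpose_mat Y) $$ (i, j)"
      using ij Y_carrier by (simp add: scalar_prod_def atLeast0LessThan del: Y_carrier sum.lessThan_Suc)
    finally show "(?N * mat_diag (2 * r) ?e * transpose_mat ?N) $$ (i, j) = (Y * transpose_mat Y) $$ (i, j)" .
  qed (use N carrier_matD[OF Y_carrier] in auto)
  then show ?thesis unfolding information_mat_def E by simp
qed

text \<open>Block diagonal, because the contrasts are orthogonal to the constant vector.\<close>

lemma YtY: "transpose_mat Y * Y = four_block_mat (mat 1 1 (\<lambda>_. real r)) (0\<^sub>m 1 r) (0\<^sub>m r 1) G"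
proof (rule eq_matI)
  have vr: "real v > 0" using k1 by simp
  fix i j assume "i < dim_row (four_block_mat (mat 1 1 (\<lambda>_. real r)) (0\<^sub>m 1 r) (0\<^sub>m r 1) G)"
    "j < dim_col (four_block_mat (mat 1 1 (\<lambda>_. real r)) (0\<^sub>m 1 r) (0\<^sub>m r 1) G)"
  then have ij: "i < Suc r" "j < Suc r" using carrier_matD[OF G_carrier] by auto
  have "(transpose_mat Y * Y) $$ (i, j) = (\<Sum>l<v. Y $$ (l, i) * Y $$ (l, j))"
    using ij Y_carrier by (simp add: scalar_prod_def atLeast0LessThan del: Y_carrier)
  also have "\<dots> = four_block_mat (mat 1 1 (\<lambda>_. real r)) (0\<^sub>m 1 r) (0\<^sub>m r 1) G $$ (i, j)"
  proof (cases i)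
    case i: 0
    show ?thesis
    proof (cases j)
      case 0
      then show ?thesis using i vr by (simp add: augmented_contrast_mat_def del: of_nat_add)
    next
      case (Suc h)
      then show ?thesis using i ij sum_X_col[of h] carrier_matD[OF G_carrier]
        by (simp add: augmented_contrast_mat_def sum_distrib_left[symmetric])
    qed
  next
    case i: (Suc g)
    show ?thesis
    proof (cases j)
      case 0
      then show ?thesis using i ij sum_X_col[of g] carrier_matD[OF G_carrier]
        by (simp add: augmented_contrast_mat_def sum_distrib_right[symmetric])
    next
      case (Suc h)
      have "(\<Sum>l<v. X $$ (l, g) * X $$ (l, h)) = G $$ (g, h)"
        unfolding gram_mat_def using ij i Suc X_carrier
        by (simp add: scalar_prod_def atLeast0LessThan del: X_carrier)
      then show ?thesis using i ij Suc carrier_matD[OF G_carrier]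
        by (simp add: augmented_contrast_mat_def)
    qed
  qed
  finally show "(transpose_mat Y * Y) $$ (i, j)
      = four_block_mat (mat 1 1 (\<lambda>_. real r)) (0\<^sub>m 1 r) (0\<^sub>m r 1) G $$ (i, j)" .
qed (use carrier_matD[OF Y_carrier] carrier_matD[OF G_carrier] in auto)

lemma C_sym: "transpose_mat C = C"
proof -
  have "transpose_mat (Y * transpose_mat Y) = Y * transpose_mat Y"
    by (simp add: transpose_mult[of _ v "Suc r" _ v])
  then show ?thesis unfolding C_eq using Y_carrier
    by (subst transpose_minus[of _ v v]) (auto simp: smult_carrier_mat simp del: Y_carrier)
qed

text \<open>Sylvester's identity passes from \<open>Y Y'\<close> to the smaller matrix \<open>Y' Y\<close>, whose eigenvalues are \<open>r\<close> and
  those of \<open>G\<close>; reflection at \<open>r\<close> turns the extra zeros into copies of \<open>r\<close> and the eigenvalue \<open>r\<close> of the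
  constant vector into \<open>0\<close>.\<close>

lemma proots_C:
  assumes "r < v"
  shows "proots (char_poly C)
    = add_mset 0 (replicate_mset (v - Suc r) (real r) + image_mset (\<lambda>\<mu>. r - \<mu>) (proots (char_poly G)))"
proof -
  have Yt: "transpose_mat Y \<in> carrier_mat (Suc r) v" by simp
  have K: "Y * transpose_mat Y \<in> carrier_mat v v" using Y_carrier Yt by (rule mult_carrier_mat)
  have K': "transpose_mat (Y * transpose_mat Y) = Y * transpose_mat Y"
    by (simp add: transpose_mult[OF Y_carrier Yt])
  have R: "mat 1 1 (\<lambda>_. real r) \<in> carrier_mat 1 1" by simp
  have "char_poly (mat 1 1 (\<lambda>_. real r)) = [:- real r, 1:]"
    by (simp add: char_poly_defs det_def sign_def)
  then have "proots (char_poly (transpose_mat Y * Y)) = add_mset (real r) (proots (char_poly G))"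
    unfolding YtY char_poly_four_block_zeros_col[OF R zero_carrier_mat G_carrier]
    using char_poly_nonzero[OF G_carrier] by (simp add: proots_mult del: mult_pCons_left)
  then have "proots (char_poly (Y * transpose_mat Y))
      = replicate_mset (v - Suc r) 0 + add_mset (real r) (proots (char_poly G))"
    using proots_char_poly_mult_commute[OF Y_carrier Yt] assms by simp
  then show ?thesis unfolding C_eq proots_char_poly_reflect[OF K K'] by simp
qed

lemma G_quad: assumes "s \<in> carrier_vec r"
  shows "s \<bullet> (G *\<^sub>v s) = (X *\<^sub>v s) \<bullet> (X *\<^sub>v s)"
  unfolding gram_mat_def using assms
  by (simp add: assoc_mult_mat_vec[of _ r v _ r] transpose_vec_mult_scalar[of _ v r])
     (metis X_carrier comm_scalar_prod mult_mat_vec_carrier transpose_carrier_mat transpose_vec_mult_scalar)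

text \<open>The Cauchy-Schwarz inequality and the unit norm of the contrasts give \<open>\<mu> \<le> r\<close>. Equality would make
  \<open>0\<close> a multiple eigenvalue of \<open>C\<close>, which connectedness excludes.\<close>

lemma G_eigenvalue_less:
  assumes r: "r < v" and conn: "connected_design r k1 k2 d" and \<mu>: "\<mu> \<in># proots (char_poly G)"
  shows "\<mu> < r"
proof -
  have "\<mu> \<le> r"
  proof -
    have "\<forall>s\<in>carrier_vec r. s \<bullet> (G *\<^sub>v s) \<le> real r * (s \<bullet> s)"
    proof
      fix s :: "real vec" assume s: "s \<in> carrier_vec r"
      have "s \<bullet> (G *\<^sub>v s) = (\<Sum>i<v. (\<Sum>h<r. X $$ (i, h) * s $ h)\<^sup>2)"
        unfolding G_quad[OF s] scalar_prod_self_eq_sum using s X_carrier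
        by (simp add: scalar_prod_def atLeast0LessThan del: X_carrier)
      also have "\<dots> \<le> (\<Sum>i<v. (\<Sum>h<r. (X $$ (i, h))\<^sup>2) * (\<Sum>h<r. (s $ h)\<^sup>2))"
        by (intro sum_mono Cauchy_Schwarz_ineq_sum)
      also have "\<dots> = (\<Sum>h<r. \<Sum>i<v. (X $$ (i, h))\<^sup>2) * (s \<bullet> s)"
        unfolding scalar_prod_self_eq_sum using s
        by (subst sum.swap) (simp add: sum_distrib_right)
      also have "(\<Sum>h<r. \<Sum>i<v. (X $$ (i, h))\<^sup>2) = (\<Sum>h<r. G $$ (h, h))"
        unfolding gram_mat_def using X_carrier
        by (intro sum.cong) (auto simp: scalar_prod_def atLeast0LessThan power2_eq_square simp del: X_carrier)
      finally show "s \<bullet> (G *\<^sub>v s) \<le> real r * (s \<bullet> s)" by (simp add: G_diag)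
    qed
    then show ?thesis using symmetric_eigenvalues_le_iff[OF G_carrier G_sym, of r] \<mu> by blast
  qed
  moreover have "real r \<notin># proots (char_poly G)"
  proof
    assume "real r \<in># proots (char_poly G)"
    then have "0 \<in># image_mset (\<lambda>\<mu>. r - \<mu>) (proots (char_poly G))" by force
    then have "count (proots (char_poly C)) 0 > 1"
      unfolding proots_C[OF r] count_greater_zero_iff[symmetric] by simp
    moreover have "count (proots (char_poly C)) 0 \<le> 1"
      using conn by (intro count_zero_le_1_if_symmetric_rank_pred[OF C_carrier C_sym])
        (simp add: connected_design_def)
    ultimately show False by simp
  qed
  ultimately show ?thesis using \<mu> by (cases "\<mu> = r") auto
qed

end

section \<open>The quadratic form of the concurrences\<close>

lemma gamma_bounds: assumes "k1 > 0" shows "0 \<le> gamma k1 k2" "gamma k1 k2 < 1"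
proof -
  let ?x = "real k1 ^ 2 / real (k1 + k2)"
  have "real (theta_bar k1 k2) = of_int \<lfloor>?x\<rfloor>" unfolding theta_bar_def by (simp add: of_nat_nat)
  then show "0 \<le> gamma k1 k2" "gamma k1 k2 < 1"
    unfolding gamma_def by (simp_all del: of_nat_add) linarith+
qed

lemma le_n_gamma_iff: assumes "k1 > 0" shows "n \<le> n_gamma k1 k2 \<longleftrightarrow> real n * (1 - gamma k1 k2) \<le> 1"
proof -
  have g: "1 - gamma k1 k2 > 0" using gamma_bounds[OF assms, of k2] by simp
  then have "n \<le> n_gamma k1 k2 \<longleftrightarrow> real n \<le> 1 / (1 - gamma k1 k2)"
    unfolding n_gamma_def by (simp add: le_nat_iff le_floor_iff)
  also have "\<dots> \<longleftrightarrow> real n * (1 - gamma k1 k2) \<le> 1" using g by (simp add: field_simps)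
  finally show ?thesis .
qed

text \<open>The diagonal value \<open>0\<close> is a convention. With it, the condition \<open>D = 0\<close> becomes reflexive, and a
  replicate is treated like two replicates of the same group.\<close>

definition concurrence_excess :: "nat \<Rightarrow> nat \<Rightarrow> design \<Rightarrow> nat \<Rightarrow> nat \<Rightarrow> real" where
  "concurrence_excess k1 k2 d h h' =
     (if h = h' then 0 else real (concurrence d h h') - real (theta_bar k1 k2))"

lemma concurrence_excess_commute:
  "concurrence_excess k1 k2 d h h' = concurrence_excess k1 k2 d h' h"
  by (simp add: concurrence_excess_def concurrence_def Int_commute)

context resolvable
begin

abbreviation "c \<equiv> gram_scale k1 k2"
abbreviation "\<gamma> \<equiv> gamma k1 k2"
abbreviation "D \<equiv> concurrence_excess k1 k2 d"

lemma c_pos: "c > 0" using k1 k2 by (simp add: gram_scale_def)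

lemma G_eq_excess:
  assumes "h < r" "h' < r"
  shows "G $$ (h, h') = (if h = h' then 1 + c * \<gamma> else 0) + c * (D h h' - \<gamma>)"
  using G_diag[OF assms(1)] G_offdiag[OF assms] by (cases "h = h'") (simp_all add: concurrence_excess_def algebra_simps)

lemma G_quad_excess:
  assumes s: "s \<in> carrier_vec r"
  shows "s \<bullet> (G *\<^sub>v s) = (1 + c * \<gamma>) * (s \<bullet> s)
    + c * ((\<Sum>h<r. \<Sum>h'<r. D h h' * s $ h * s $ h') - \<gamma> * (\<Sum>h<r. s $ h)\<^sup>2)"
proof -
  have "s \<bullet> (G *\<^sub>v s) = (\<Sum>h<r. \<Sum>h'<r. G $$ (h, h') * s $ h * s $ h')"
    using s carrier_matD[OF G_carrier] by (simp add: scalar_prod_def atLeast0LessThan sum_distrib_left mult_ac)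
  also have "\<dots> = (\<Sum>h<r. \<Sum>h'<r. (if h = h' then (1 + c * \<gamma>) * (s $ h)\<^sup>2 else 0)
      + (c * (D h h' * s $ h * s $ h') - c * \<gamma> * (s $ h * s $ h')))"
  proof (intro sum.cong refl)
    fix h h' assume "h \<in> {..<r}" "h' \<in> {..<r}"
    then have e: "G $$ (h, h') = (if h = h' then 1 + c * \<gamma> else 0) + c * (D h h' - \<gamma>)"
      by (intro G_eq_excess) auto
    show "G $$ (h, h') * s $ h * s $ h' = (if h = h' then (1 + c * \<gamma>) * (s $ h)\<^sup>2 else 0)
      + (c * (D h h' * s $ h * s $ h') - c * \<gamma> * (s $ h * s $ h'))"
      unfolding e by (simp add: power2_eq_square algebra_simps)
  qed
  also have "\<dots> = (\<Sum>h<r. (1 + c * \<gamma>) * (s $ h)\<^sup>2)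
      + (c * (\<Sum>h<r. \<Sum>h'<r. D h h' * s $ h * s $ h') - c * \<gamma> * (\<Sum>h<r. \<Sum>h'<r. s $ h * s $ h'))"
    by (simp add: sum.distrib sum_subtractf sum_distrib_left)
  also have "(\<Sum>h<r. \<Sum>h'<r. s $ h * s $ h') = (\<Sum>h<r. s $ h)\<^sup>2"
    unfolding power2_eq_square by (rule sum_product[symmetric])
  also have "(\<Sum>h<r. (1 + c * \<gamma>) * (s $ h)\<^sup>2) = (1 + c * \<gamma>) * (s \<bullet> s)"
    using s by (simp only: scalar_prod_self_eq_sum sum_distrib_left carrier_vecD)
  finally show ?thesis by (simp add: algebra_simps)
qed

text \<open>The form in which bounds are tested: \<open>s\<close> is extended by zero outside \<open>F\<close>, so that for small \<open>F\<close> the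
  sums become explicit.\<close>

lemma G_quad_bound_on:
  assumes bound: "\<forall>s\<in>carrier_vec r. s \<bullet> (G *\<^sub>v s) \<le> m * (s \<bullet> s)" and F: "F \<subseteq> {..<r}"
  shows "(1 + c * \<gamma>) * (\<Sum>h\<in>F. (s h)\<^sup>2)
    + c * ((\<Sum>h\<in>F. \<Sum>h'\<in>F. D h h' * s h * s h') - \<gamma> * (\<Sum>h\<in>F. s h)\<^sup>2) \<le> m * (\<Sum>h\<in>F. (s h)\<^sup>2)"
proof -
  define w where "w = vec r (\<lambda>h. if h \<in> F then s h else 0)"
  have w: "w \<in> carrier_vec r" by (simp add: w_def)
  have restr: "(\<Sum>h<r. if h \<in> F then g h else 0) = sum g F" for g :: "nat \<Rightarrow> real"
    using F by (simp add: sum.If_cases Int_absorb1)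
  have 1: "w \<bullet> w = (\<Sum>h\<in>F. (s h)\<^sup>2)"
  proof -
    have "w \<bullet> w = (\<Sum>h<r. if h \<in> F then (s h)\<^sup>2 else 0)"
      unfolding scalar_prod_self_eq_sum by (intro sum.cong) (auto simp: w_def)
    then show ?thesis by (simp only: restr)
  qed
  have 2: "(\<Sum>h<r. w $ h) = (\<Sum>h\<in>F. s h)"
    unfolding restr[symmetric] by (intro sum.cong) (auto simp: w_def)
  have 3: "(\<Sum>h<r. \<Sum>h'<r. D h h' * w $ h * w $ h') = (\<Sum>h\<in>F. \<Sum>h'\<in>F. D h h' * s h * s h')"
    unfolding restr[symmetric] by (intro sum.cong refl) (auto simp: w_def intro!: sum.cong)
  show ?thesis using bound[rule_format, OF w] unfolding G_quad_excess[OF w] 1 2 3 .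
qed

text \<open>The universal lower bound on the largest eigenvalue of \<open>G\<close>, in terms of any upper bound \<open>m\<close> of the
  Rayleigh quotient. The test vectors are the difference of two coordinate vectors and the all-one
  vector.\<close>

lemma G_quad_bound_lower:
  assumes bound: "\<forall>s\<in>carrier_vec r. s \<bullet> (G *\<^sub>v s) \<le> m * (s \<bullet> s)" and "r > 0"
  shows "1 + c * \<gamma> \<le> m \<or> 1 + (real r - 1) * (c * (1 - \<gamma>)) \<le> m"
proof (cases "\<exists>h<r. \<exists>h'<r. h \<noteq> h' \<and> concurrence d h h' \<le> theta_bar k1 k2")
  case True
  then obtain h h' where h: "h < r" "h' < r" "h \<noteq> h'" and le: "D h h' \<le> 0"
    by (auto simp: concurrence_excess_def)
  have "c * D h h' \<le> 0" using c_pos le by (intro mult_nonneg_nonpos) linarith+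
  moreover have "D h' h = D h h'" by (rule concurrence_excess_commute)
  moreover have "D x x = 0" for x by (simp add: concurrence_excess_def)
  ultimately show ?thesis
    using G_quad_bound_on[OF bound, of "{h, h'}" "\<lambda>x. if x = h then 1 else - 1"] h
    by (simp add: algebra_simps)
next
  case False
  then have "1 - of_bool (h = h') \<le> D h h'" if "h < r" "h' < r" for h h'
  proof (cases "h = h'")
    case ne: False
    have "\<not> concurrence d h h' \<le> theta_bar k1 k2" using False that ne by blast
    then have "real (theta_bar k1 k2) + 1 \<le> real (concurrence d h h')" by linarith
    with ne show ?thesis by (simp add: concurrence_excess_def)
  qed (simp add: concurrence_excess_def)
  then have "(\<Sum>h<r. \<Sum>h'<r. 1 - of_bool (h = h')) \<le> (\<Sum>h<r. \<Sum>h'<r. D h h')"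
    by (intro sum_mono) auto
  moreover have "(\<Sum>h<r. \<Sum>h'<r. 1 - of_bool (h = h')) = real r * (real r - 1)"
    by (simp add: sum_subtractf algebra_simps)
  ultimately have "real r * (real r - 1) \<le> (\<Sum>h<r. \<Sum>h'<r. D h h')" by simp
  then have "c * (real r * (real r - 1)) \<le> c * (\<Sum>h<r. \<Sum>h'<r. D h h')"
    using c_pos by (intro mult_left_mono) linarith+
  moreover have "(1 + c * \<gamma>) * real r + c * ((\<Sum>h<r. \<Sum>h'<r. D h h') - \<gamma> * (real r)\<^sup>2) \<le> m * real r"
    using G_quad_bound_on[OF bound subset_refl, of "\<lambda>_. 1"] by simp
  ultimately have "(1 + (real r - 1) * (c * (1 - \<gamma>))) * real r \<le> m * real r"
    by (simp add: algebra_simps power2_eq_square)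
  then show ?thesis using \<open>r > 0\<close> by simp
qed

end

section \<open>Group-affine designs\<close>

context resolvable
begin

text \<open>The combinatorial core: the designs attaining the bound \<open>1 + c \<gamma>\<close> are recognized by a quadratic
  inequality for \<open>D\<close> alone.\<close>

lemma group_affine_iff_excess:
  "(\<exists>n. group_affine r k1 k2 d n \<and> n \<le> n_gamma k1 k2) \<longleftrightarrow>
     (\<forall>s :: nat \<Rightarrow> real. (\<Sum>h<r. \<Sum>h'<r. D h h' * s h * s h') \<le> \<gamma> * (\<Sum>h<r. s h)\<^sup>2)"
  (is "?L \<longleftrightarrow> ?R")
proof
  assume ?L
  then obtain n t where n: "n \<le> n_gamma k1 k2" and "group_affine_sizes r k1 k2 d n t"
    by (auto simp: group_affine_def)
  then obtain P where disj: "disjoint_family_on P {..<n}" and un: "(\<Union>i<n. P i) = {..<r}"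
    and P: "\<forall>i<n. \<forall>h\<in>P i. \<forall>h'\<in>P i. h \<noteq> h' \<longrightarrow> concurrence d h h' = theta_bar k1 k2"
      "\<forall>i<n. \<forall>j<n. i \<noteq> j \<longrightarrow> (\<forall>h\<in>P i. \<forall>h'\<in>P j. concurrence d h h' = theta_bar k1 k2 + 1)"
    unfolding group_affine_sizes_def by (elim conjE exE) (rule that)
  have same: "concurrence d h h' = theta_bar k1 k2"
    if "i < n" "h \<in> P i" "h' \<in> P i" "h \<noteq> h'" for i h h'
    using P(1) that by blast
  have diff: "concurrence d h h' = theta_bar k1 k2 + 1"
    if "i < n" "j < n" "i \<noteq> j" "h \<in> P i" "h' \<in> P j" for i j h h'
    using P(2) that by blast
  have sub: "P i \<subseteq> {..<r}" if "i < n" for i using un that by blast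
  have uniq: "i = j" if "i < n" "j < n" "h \<in> P i" "h \<in> P j" for i j h
    using disj that by (auto simp: disjoint_family_on_def)
  \<comment> \<open>The sum counts the groups containing both replicates: there is one or none.\<close>
  have Dform: "D h h' = 1 - (\<Sum>i<n. of_bool (h \<in> P i) * of_bool (h' \<in> P i))" if h: "h < r" "h' < r" for h h'
  proof -
    have "h \<in> (\<Union>i<n. P i)" "h' \<in> (\<Union>i<n. P i)" using h un by auto
    then obtain i j where ij: "i < n" "h \<in> P i" "j < n" "h' \<in> P j" by auto
    have "(\<Sum>l<n. of_bool (h \<in> P l) * of_bool (h' \<in> P l)) = (\<Sum>l<n. if l = i then of_bool (i = j) else (0::real))"
      using ij uniq by (intro sum.cong) auto
    also have "\<dots> = of_bool (i = j)" using ij by simp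
    finally have e: "(\<Sum>l<n. of_bool (h \<in> P l) * of_bool (h' \<in> P l)) = (of_bool (i = j) :: real)" .
    show ?thesis unfolding e concurrence_excess_def
      using ij same[of i h h'] diff[of i j h h'] uniq[of i j h] by auto
  qed
  show ?R
  proof
    fix s :: "nat \<Rightarrow> real"
    define T where "T i = (\<Sum>h\<in>P i. s h)" for i
    have T: "T i = (\<Sum>h<r. of_bool (h \<in> P i) * s h)" if "i < n" for i
    proof -
      have "(\<Sum>h<r. of_bool (h \<in> P i) * s h) = (\<Sum>h<r. if h \<in> P i then s h else 0)"
        by (intro sum.cong) auto
      then show ?thesis unfolding T_def using sub[OF that] by (simp add: sum.If_cases Int_absorb1)
    qed
    have tot: "(\<Sum>i<n. T i) = (\<Sum>h<r. s h)"
      unfolding T_def un[symmetric] using disj finite_subset[OF sub]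
      by (intro sum.UNION_disjoint[symmetric]) (auto simp: disjoint_family_on_def)
    have "(\<Sum>h<r. \<Sum>h'<r. D h h' * s h * s h')
        = (\<Sum>h<r. \<Sum>h'<r. s h * s h' - (\<Sum>i<n. of_bool (h \<in> P i) * s h * (of_bool (h' \<in> P i) * s h')))"
    proof (intro sum.cong refl)
      fix h h' assume "h \<in> {..<r}" "h' \<in> {..<r}"
      then show "D h h' * s h * s h' = s h * s h' - (\<Sum>i<n. of_bool (h \<in> P i) * s h * (of_bool (h' \<in> P i) * s h'))"
        by (simp add: Dform left_diff_distrib right_diff_distrib sum_distrib_right sum_distrib_left mult_ac
            del: sum_of_bool_mult_eq sum_mult_of_bool_eq)
    qed
    also have "\<dots> = (\<Sum>h<r. \<Sum>h'<r. s h * s h')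
        - (\<Sum>i<n. \<Sum>h<r. \<Sum>h'<r. of_bool (h \<in> P i) * s h * (of_bool (h' \<in> P i) * s h'))"
      unfolding sum_subtractf
      by (subst sum.swap[of _ "{..<n}"], rule arg_cong2[of _ _ _ _ "(-)"], simp)
        (intro sum.cong refl sum.swap)
    also have "\<dots> = (\<Sum>h<r. s h)\<^sup>2 - (\<Sum>i<n. (T i)\<^sup>2)"
    proof -
      have "(T i)\<^sup>2 = (\<Sum>h<r. \<Sum>h'<r. of_bool (h \<in> P i) * s h * (of_bool (h' \<in> P i) * s h'))"
        if "i < n" for i
        unfolding T[OF that] power2_eq_square by (rule sum_product)
      then show ?thesis by (simp add: power2_eq_square sum_product[of s "{..<r}" s "{..<r}"])
    qed
    finally have q: "(\<Sum>h<r. \<Sum>h'<r. D h h' * s h * s h') = (\<Sum>h<r. s h)\<^sup>2 - (\<Sum>i<n. (T i)\<^sup>2)" .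
    have "(\<Sum>h<r. s h)\<^sup>2 \<le> real n * (\<Sum>i<n. (T i)\<^sup>2)"
      using Cauchy_Schwarz_ineq_sum[of T "\<lambda>_. 1" "{..<n}"] by (simp add: tot mult.commute)
    then have "(1 - \<gamma>) * (\<Sum>h<r. s h)\<^sup>2 \<le> (1 - \<gamma>) * (real n * (\<Sum>i<n. (T i)\<^sup>2))"
      using gamma_bounds[OF k1, of k2] by (intro mult_left_mono) auto
    also have "\<dots> = (real n * (1 - \<gamma>)) * (\<Sum>i<n. (T i)\<^sup>2)" by simp
    also have "\<dots> \<le> 1 * (\<Sum>i<n. (T i)\<^sup>2)"
      using n by (intro mult_right_mono) (auto simp: le_n_gamma_iff[OF k1] sum_nonneg)
    finally show "(\<Sum>h<r. \<Sum>h'<r. D h h' * s h * s h') \<le> \<gamma> * (\<Sum>h<r. s h)\<^sup>2"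
      unfolding q by (simp add: algebra_simps)
  qed
next
  assume R: ?R
  have RF: "(\<Sum>h\<in>F. \<Sum>h'\<in>F. D h h' * s h * s h') \<le> \<gamma> * (\<Sum>h\<in>F. s h)\<^sup>2"
    if F: "F \<subseteq> {..<r}" for F and s :: "nat \<Rightarrow> real"
  proof -
    have restr: "(\<Sum>h<r. if h \<in> F then g h else 0) = sum g F" for g :: "nat \<Rightarrow> real"
      using F by (simp add: sum.If_cases Int_absorb1)
    have "(\<Sum>h\<in>F. \<Sum>h'\<in>F. D h h' * s h * s h')
        = (\<Sum>h<r. \<Sum>h'<r. D h h' * (if h \<in> F then s h else 0) * (if h' \<in> F then s h' else 0))"
      unfolding restr[symmetric] by (intro sum.cong refl) (auto intro!: sum.cong)
    then show ?thesis using R[rule_format, of "\<lambda>h. if h \<in> F then s h else 0"] by (simp add: restr)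
  qed
  have Dsym: "D h h' = D h' h" for h h' by (rule concurrence_excess_commute)
  have D0: "D h h = 0" for h by (simp add: concurrence_excess_def)
  have D01: "D h h' = 0 \<or> D h h' = 1" if "h < r" "h' < r" for h h'
  proof (cases "h = h'")
    case False
    \<comment> \<open>The vectors \<open>e_h - e_h'\<close> and \<open>e_h + e_h'\<close> have values \<open>- 2 D\<close> and \<open>2 D\<close> under \<open>D\<close>, and coordinate
      sums \<open>0\<close> and \<open>2\<close>.\<close>
    have "0 \<le> D h h'"
      using RF[of "{h, h'}" "\<lambda>x. if x = h then 1 else - 1"] False that
      by (simp add: D0 Dsym[of h' h])
    moreover have "D h h' < 2"
      using RF[of "{h, h'}" "\<lambda>_. 1"] False that gamma_bounds(2)[OF k1, of k2]
      by (simp add: D0 Dsym[of h' h])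
    moreover have "D h h' = of_int (int (concurrence d h h') - int (theta_bar k1 k2))"
      using False by (simp add: concurrence_excess_def)
    ultimately have "int (concurrence d h h') - int (theta_bar k1 k2) \<in> {0, 1}" by auto
    then show ?thesis using False by (auto simp: concurrence_excess_def)
  qed (simp add: D0)
  have Dtrans: "D h h'' = 0" if "h < r" "h' < r" "h'' < r" "D h h' = 0" "D h' h'' = 0" for h h' h''
  proof (cases "h = h' \<or> h' = h'' \<or> h = h''")
    case False
    \<comment> \<open>The vector \<open>e_h - 2 e_h' + e_h''\<close> has coordinate sum zero, and its value under \<open>D\<close> is \<open>2 D h h''\<close>
      since the other two entries vanish.\<close>
    have "D h h'' \<le> 0"
      using RF[of "{h, h', h''}" "\<lambda>x. if x = h' then - 2 else 1"] False that
      by (simp add: D0 Dsym[of h' h] Dsym[of h'' h] Dsym[of h'' h'])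
    with D01[of h h''] that show ?thesis by auto
  qed (use that D0 in auto)
  define E where "E = {(h, h'). h < r \<and> h' < r \<and> D h h' = 0}"
  have E: "equiv {..<r} E"
  proof (rule equivI)
    show "E \<subseteq> {..<r} \<times> {..<r}" by (auto simp: E_def)
    show "refl_on {..<r} E" by (auto simp: refl_on_def E_def D0)
    show "sym E" by (auto simp: sym_def E_def Dsym)
    show "trans E" unfolding trans_def E_def using Dtrans by blast
  qed
  define Q where "Q = {..<r} // E"
  have finQ: "finite Q" unfolding Q_def by (rule finite_quotient[OF _ E[THEN equiv_type]]) simp
  have Qne: "A \<noteq> {}" and Qsub: "A \<subseteq> {..<r}" if "A \<in> Q" for A
    using that E by (auto simp: Q_def in_quotient_imp_non_empty dest: in_quotient_imp_subset)
  have Qun: "\<Union>Q = {..<r}" unfolding Q_def by (rule Union_quotient[OF E])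
  have Qdisj: "A = B" if "A \<in> Q" "B \<in> Q" "x \<in> A" "x \<in> B" for A B x
    using quotient_disj[OF E, of A B] that by (auto simp: Q_def)
  have same: "D h h' = 0" if "A \<in> Q" "h \<in> A" "h' \<in> A" for A h h'
    using in_quotient_imp_in_rel[OF E, of A h h'] that by (auto simp: Q_def E_def)
  have diff: "D h h' = 1" if "A \<in> Q" "B \<in> Q" "A \<noteq> B" "h \<in> A" "h' \<in> B" for A B h h'
  proof -
    have hr: "h < r" "h' < r" using that Qsub by blast+
    have "D h h' \<noteq> 0"
    proof
      assume "D h h' = 0"
      then have "(h, h') \<in> E" using hr by (simp add: E_def)
      then have "h' \<in> A" using in_quotient_imp_closed[OF E, of A h h'] that by (simp add: Q_def)
      then show False using Qdisj[of A B h'] that by blast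
    qed
    then show ?thesis using D01[OF hr] by blast
  qed
  have small: "real (card Q) * (1 - \<gamma>) \<le> 1"
  proof -
    \<comment> \<open>Distinct representatives have \<open>D = 1\<close>, so the indicator of a set of \<open>n\<close> representatives gives
      \<open>n (n - 1) \<le> \<gamma> n\<^sup>2\<close>.\<close>
    define \<rho> where "\<rho> A = (SOME h. h \<in> A)" for A :: "nat set"
    have \<rho>: "\<rho> A \<in> A" if "A \<in> Q" for A unfolding \<rho>_def using Qne[OF that] by (simp add: some_in_eq)
    have inj: "inj_on \<rho> Q" by (rule inj_onI) (metis \<rho> Qdisj)
    have "(\<Sum>h\<in>\<rho> ` Q. \<Sum>h'\<in>\<rho> ` Q. D h h' * 1 * 1) \<le> \<gamma> * (\<Sum>h\<in>\<rho> ` Q. 1)\<^sup>2"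
      by (rule RF) (use \<rho> Qsub in blast)
    moreover have "(\<Sum>h\<in>\<rho> ` Q. \<Sum>h'\<in>\<rho> ` Q. D h h' * 1 * 1) = (\<Sum>A\<in>Q. \<Sum>B\<in>Q. D (\<rho> A) (\<rho> B))"
      using inj by (simp add: sum.reindex)
    moreover have "\<dots> = (\<Sum>A\<in>Q. \<Sum>B\<in>Q. 1 - of_bool (A = B))"
      using \<rho> diff by (intro sum.cong refl) (auto simp: D0)
    moreover have "\<dots> = real (card Q) * (real (card Q) - 1)"
      using finQ by (simp add: sum_subtractf algebra_simps)
    moreover have "(\<Sum>h\<in>\<rho> ` Q. 1) = real (card Q)" using inj by (simp add: card_image)
    ultimately have "real (card Q) * (real (card Q) * (1 - \<gamma>)) \<le> real (card Q) * 1"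
      by (simp add: algebra_simps power2_eq_square)
    then show ?thesis by (cases "card Q = 0") (auto simp: mult_le_cancel_left_pos)
  qed
  obtain L0 where L0: "set L0 = Q" "distinct L0" using finite_distinct_list[OF finQ] by blast
  \<comment> \<open>The classes are enumerated by size because a list of group sizes has to be sorted.\<close>
  define L where "L = sort_key card L0"
  have L: "set L = Q" "distinct L" "sorted (map card L)" using L0 by (auto simp: L_def)
  define n where "n = length L"
  have n: "n = card Q" using L distinct_card by (metis n_def)
  have LQ: "L ! i \<in> Q" if "i < n" for i using that L(1) by (auto simp: n_def)
  have "(\<lambda>i. L ! i) ` {..<n} = Q" unfolding L(1)[symmetric] by (auto simp: n_def set_conv_nth)
  then have un: "(\<Union>i<n. L ! i) = {..<r}" using Qun by simp
  have disj: "disjoint_family_on (\<lambda>i. L ! i) {..<n}"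
    unfolding disjoint_family_on_def
    using Qdisj LQ L(2) by (auto simp: n_def nth_eq_iff_index_eq) (metis nth_eq_iff_index_eq nth_mem)
  have finQA: "finite A" if "A \<in> Q" for A using finite_subset[OF Qsub[OF that]] by simp
  have card_pos: "0 < card A" if "A \<in> Q" for A
    using Qne[OF that] finQA[OF that] by (simp add: card_gt_0_iff)
  have "sum_list (map card L) = sum card Q" using L by (simp add: sum_list_distinct_conv_sum_set)
  also have "\<dots> = card (\<Union>Q)"
    using Qdisj finQA by (intro card_Union_disjoint[symmetric]) (auto simp: pairwise_def disjnt_iff)
  finally have total: "sum_list (map card L) = r" by (simp add: Qun)
  have "group_affine_sizes r k1 k2 d n (map card L)"
    unfolding group_affine_sizes_def
  proof (intro conjI exI[of _ "\<lambda>i. L ! i"] allI impI ballI)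
    fix i h h' assume "i < n" "h \<in> L ! i" "h' \<in> L ! i" "h \<noteq> h'"
    then show "concurrence d h h' = theta_bar k1 k2"
      using same[of "L ! i" h h'] LQ by (simp add: concurrence_excess_def)
  next
    fix i j h h' assume ij: "i < n" "j < n" "i \<noteq> j" "h \<in> L ! i" "h' \<in> L ! j"
    then have "L ! i \<noteq> L ! j" using L(2) by (simp add: n_def nth_eq_iff_index_eq)
    then have "D h h' = 1" using diff[of "L ! i" "L ! j" h h'] LQ ij by simp
    then show "concurrence d h h' = theta_bar k1 k2 + 1"
      by (simp add: concurrence_excess_def split: if_splits)
  qed (use L total un disj card_pos LQ in \<open>auto simp: n_def\<close>)
  then show ?L using small by (auto simp: group_affine_def n le_n_gamma_iff[OF k1])
qed

end

section \<open>Equal concurrence designs\<close>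

context resolvable
begin

text \<open>Here \<open>G\<close> is a combination of the identity and the all-one matrix. Its eigenvalues can only be
  the two values stated, and the trace \<open>r\<close> then determines their multiplicities.\<close>

lemma ecd_spectrum:
  assumes ecd: "equal_concurrence r d (theta_bar k1 k2 + 1)" and r: "r \<ge> 2"
  shows "proots (char_poly G) = add_mset (1 + (real r - 1) * (c * (1 - \<gamma>)))
    (replicate_mset (r - 1) (1 - c * (1 - \<gamma>)))"
proof -
  define \<beta> where "\<beta> = c * (1 - \<gamma>)"
  define a where "a = 1 + (real r - 1) * \<beta>"
  define b where "b = 1 - \<beta>"
  let ?M = "proots (char_poly G)"
  have \<beta>: "\<beta> > 0" unfolding \<beta>_def using c_pos gamma_bounds[OF k1, of k2] by simp
  have ab: "a - b = real r * \<beta>" by (simp add: a_def b_def algebra_simps)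
  then have "a \<noteq> b" using \<beta> r by auto
  have entry: "G $$ (h, h') = \<beta> + (if h = h' then b else 0)" if "h < r" "h' < r" for h h'
    using that ecd G_diag[OF that(1)] G_offdiag[OF that]
    by (auto simp: equal_concurrence_def \<beta>_def b_def algebra_simps)
  have sub: "\<mu> = a \<or> \<mu> = b" if "\<mu> \<in># ?M" for \<mu>
  proof (rule disjCI)
    assume "\<mu> \<noteq> b"
    from that have "eigenvalue G \<mu>"
      using char_poly_nonzero[OF G_carrier] by (simp add: eigenvalue_root_char_poly[OF G_carrier])
    then obtain s where s: "s \<in> carrier_vec r" "s \<noteq> 0\<^sub>v r" "G *\<^sub>v s = \<mu> \<cdot>\<^sub>v s"
      unfolding eigenvalue_def eigenvector_def using carrier_matD[OF G_carrier] by auto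
    define \<sigma> where "\<sigma> = (\<Sum>h<r. s $ h)"
    \<comment> \<open>Each row of \<open>G s = \<mu> s\<close> says that \<open>(\<mu> - b) s_h\<close> is the same multiple of the coordinate sum \<open>\<sigma>\<close>; adding
      the \<open>r\<close> rows gives \<open>\<mu>\<close>.\<close>
    have row: "\<beta> * \<sigma> = (\<mu> - b) * s $ h" if "h < r" for h
    proof -
      have "\<mu> * s $ h = (\<Sum>h'<r. G $$ (h, h') * s $ h')"
        using arg_cong[OF s(3), of "\<lambda>u. u $ h"] that s(1) carrier_matD[OF G_carrier]
        by (simp add: scalar_prod_def atLeast0LessThan)
      also have "\<dots> = (\<Sum>h'<r. \<beta> * s $ h' + (if h = h' then b * s $ h' else 0))"
        using that by (intro sum.cong) (auto simp: entry algebra_simps)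
      also have "\<dots> = \<beta> * \<sigma> + b * s $ h" using that by (simp add: sum.distrib \<sigma>_def sum_distrib_left)
      finally show ?thesis by (simp add: algebra_simps)
    qed
    have "\<sigma> \<noteq> 0"
    proof
      assume "\<sigma> = 0"
      then have "s $ h = 0" if "h < r" for h using row[OF that] \<open>\<mu> \<noteq> b\<close> by simp
      then show False using s(1,2) by (auto simp: vec_eq_iff)
    qed
    have "real r * (\<beta> * \<sigma>) = (\<Sum>h<r. \<beta> * \<sigma>)" by simp
    also have "\<dots> = (\<Sum>h<r. (\<mu> - b) * s $ h)" by (intro sum.cong refl row) simp
    also have "\<dots> = (\<mu> - b) * \<sigma>" by (simp add: \<sigma>_def sum_distrib_left)
    finally have "real r * \<beta> = \<mu> - b" using \<open>\<sigma> \<noteq> 0\<close> by (simp add: mult.assoc[symmetric])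
    with ab show "\<mu> = a" by simp
  qed
  have M: "?M = replicate_mset (count ?M a) a + replicate_mset (count ?M b) b"
    using sub \<open>a \<noteq> b\<close> by (intro multiset_eqI) (auto simp: count_eq_zero_iff)
  have size: "count ?M a + count ?M b = r"
    using arg_cong[OF M, of size] symmetric_size_spectrum[OF G_carrier G_sym] by simp
  have "sum_mset ?M = real (count ?M a) * a + real (count ?M b) * b"
    by (subst M) simp
  moreover have "sum_mset ?M = real r"
    unfolding symmetric_trace[OF G_carrier G_sym] by (simp add: G_diag)
  ultimately have "real (count ?M a) * a + real (count ?M b) * b = real r" by simp
  moreover have "real (count ?M b) = real r - real (count ?M a)" using size by linarith
  ultimately have "real (count ?M a) * (a - b) + real r * b = real r" by (simp add: algebra_simps)
  then have "real (count ?M a) * (real r * \<beta>) + real r * b = real r" unfolding ab .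
  then have "(real (count ?M a) - 1) * (real r * \<beta>) = 0" by (simp add: b_def algebra_simps)
  then have ka: "count ?M a = 1" using \<beta> r by simp
  with size have kb: "count ?M b = r - 1" by simp
  have "?M = add_mset a (replicate_mset (r - 1) b)" using M unfolding ka kb by simp
  then show ?thesis by (simp add: a_def b_def \<beta>_def)
qed

end

section \<open>Eigenvalues of connected designs\<close>

locale connected_resolvable = resolvable +
  assumes r_pos: "0 < r" and r_less: "r < k1 + k2" and conn: "connected_design r k1 k2 d"
begin

lemma nonzero_eigenvalues_eq:
  "nonzero_eigenvalues r k1 k2 d = sorted_list_of_multiset
     (replicate_mset (v - Suc r) (real r) + image_mset (\<lambda>\<mu>. r - \<mu>) (proots (char_poly G)))"
proof -
  let ?R = "replicate_mset (v - Suc r) (real r) + image_mset (\<lambda>\<mu>. r - \<mu>) (proots (char_poly G))"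
  have "filter_mset (\<lambda>x. x \<noteq> 0) ?R = ?R"
    unfolding filter_mset_eq_conv using G_eigenvalue_less[OF r_less conn] r_pos
    by (auto split: if_splits)
  then show ?thesis unfolding nonzero_eigenvalues_def proots_C[OF r_less] by simp
qed

lemma length_nonzero_eigenvalues: "length (nonzero_eigenvalues r k1 k2 d) = v - 1"
proof -
  have "length (nonzero_eigenvalues r k1 k2 d) = (v - Suc r) + r"
    unfolding nonzero_eigenvalues_eq size_mset[symmetric] mset_sorted_list_of_multiset
    by (simp add: symmetric_size_spectrum[OF G_carrier G_sym])
  then show ?thesis using r_less by simp
qed

lemma sum_eigval:
  "(\<Sum>i = 1..v - 1. f (eigval r k1 k2 d i))
    = real (v - Suc r) * f (real r) + (\<Sum>z\<in>#image_mset (\<lambda>\<mu>. r - \<mu>) (proots (char_poly G)). f z)"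
proof -
  have "(\<Sum>i = 1..v - 1. f (eigval r k1 k2 d i)) = (\<Sum>i<v - 1. f (nonzero_eigenvalues r k1 k2 d ! i))"
    unfolding eigval_def by (rule sum.reindex_bij_witness[of _ Suc "\<lambda>i. i - 1"]) auto
  also have "\<dots> = (\<Sum>z\<in>#mset (nonzero_eigenvalues r k1 k2 d). f z)"
    unfolding mset_map[symmetric] sum_mset_sum_list sum_list_sum_nth
    by (simp add: length_nonzero_eigenvalues atLeast0LessThan)
  finally show ?thesis unfolding nonzero_eigenvalues_eq by simp
qed

text \<open>The copies of \<open>r\<close> in the spectrum respect the bound because \<open>m\<close> is nonnegative.\<close>

lemma eigval_1_ge_iff:
  assumes "m \<ge> 0"
  shows "real r - m \<le> eigval r k1 k2 d 1 \<longleftrightarrow> (\<forall>\<mu>\<in>#proots (char_poly G). \<mu> \<le> m)"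
proof -
  let ?Z = "nonzero_eigenvalues r k1 k2 d"
  have ne: "?Z \<noteq> []" using length_nonzero_eigenvalues r_less r_pos by auto
  have "sorted ?Z" by (simp add: nonzero_eigenvalues_def)
  with ne have "real r - m \<le> ?Z ! 0 \<longleftrightarrow> (\<forall>z\<in>set ?Z. real r - m \<le> z)"
    by (cases ?Z) (auto intro: order_trans)
  also have "\<dots> \<longleftrightarrow> (\<forall>\<mu>\<in>#proots (char_poly G). \<mu> \<le> m)"
    unfolding nonzero_eigenvalues_eq using assms by auto
  finally show ?thesis by (simp add: eigval_def)
qed

lemma G_eigenvalue_exceeds:
  obtains \<mu> where "\<mu> \<in># proots (char_poly G)"
    "1 + c * \<gamma> \<le> \<mu> \<or> 1 + (real r - 1) * (c * (1 - \<gamma>)) \<le> \<mu>"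
proof -
  let ?M = "proots (char_poly G)"
  have "?M \<noteq> {#}" using symmetric_size_spectrum[OF G_carrier G_sym] r_pos by auto
  then have ne: "set_mset ?M \<noteq> {}" by simp
  define m where "m = Max (set_mset ?M)"
  have "m \<in># ?M" unfolding m_def using ne by (intro Max_in) auto
  have "\<forall>\<mu>\<in>#?M. \<mu> \<le> m" unfolding m_def by (auto intro: Max_ge)
  then have "\<forall>s\<in>carrier_vec r. s \<bullet> (G *\<^sub>v s) \<le> m * (s \<bullet> s)"
    by (simp add: symmetric_eigenvalues_le_iff[OF G_carrier G_sym])
  from G_quad_bound_lower[OF this r_pos] show thesis using that[OF \<open>m \<in># ?M\<close>] by blast
qed

text \<open>For these \<open>\<gamma>\<close> the bound \<open>1 + c \<gamma>\<close> is the smaller of the two lower bounds on the largest eigenvalue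
  of \<open>G\<close>, so it holds in either case.\<close>

lemma eigval_1_le:
  assumes "\<gamma> \<le> (real r - 1) / real r"
  shows "eigval r k1 k2 d 1 \<le> real r - (1 + c * \<gamma>)"
proof -
  have "real r * \<gamma> \<le> real r - 1" using assms r_pos by (simp add: field_simps)
  then have "\<gamma> \<le> (real r - 1) * (1 - \<gamma>)" by (simp add: algebra_simps)
  then have "c * \<gamma> \<le> c * ((real r - 1) * (1 - \<gamma>))" using c_pos by (intro mult_left_mono) auto
  also have "\<dots> = (real r - 1) * (c * (1 - \<gamma>))" by simp
  finally obtain \<mu> where \<mu>: "\<mu> \<in># proots (char_poly G)" "1 + c * \<gamma> \<le> \<mu>"
    using G_eigenvalue_exceeds by (metis add_left_mono order_trans)
  let ?Z = "nonzero_eigenvalues r k1 k2 d"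
  have "real r - \<mu> \<in> set ?Z" unfolding nonzero_eigenvalues_eq using \<mu>(1) by auto
  moreover have "sorted ?Z" by (simp add: nonzero_eigenvalues_def)
  ultimately have "eigval r k1 k2 d 1 \<le> real r - \<mu>"
    unfolding eigval_def by (cases ?Z) auto
  with \<mu>(2) show ?thesis by simp
qed

lemma eigval_1_ge_iff_group_affine:
  "real r - (1 + c * \<gamma>) \<le> eigval r k1 k2 d 1 \<longleftrightarrow>
    (\<exists>n. group_affine r k1 k2 d n \<and> n \<le> n_gamma k1 k2)"
proof -
  have "c * \<gamma> \<ge> 0" using c_pos gamma_bounds[OF k1, of k2] by simp
  then have "real r - (1 + c * \<gamma>) \<le> eigval r k1 k2 d 1
      \<longleftrightarrow> (\<forall>s\<in>carrier_vec r. s \<bullet> (G *\<^sub>v s) \<le> (1 + c * \<gamma>) * (s \<bullet> s))"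
    unfolding symmetric_eigenvalues_le_iff[OF G_carrier G_sym, symmetric]
    by (intro eigval_1_ge_iff) simp
  also have "\<dots> \<longleftrightarrow> (\<forall>s\<in>carrier_vec r.
      (\<Sum>h<r. \<Sum>h'<r. D h h' * s $ h * s $ h') \<le> \<gamma> * (\<Sum>h<r. s $ h)\<^sup>2)"
    using c_pos by (intro ball_cong refl) (simp add: G_quad_excess mult_le_0_iff)
  also have "\<dots> \<longleftrightarrow> (\<forall>s :: nat \<Rightarrow> real.
      (\<Sum>h<r. \<Sum>h'<r. D h h' * s h * s h') \<le> \<gamma> * (\<Sum>h<r. s h)\<^sup>2)" (is "?V \<longleftrightarrow> ?S")
  proof
    assume V: ?V
    show ?S
    proof
      fix s :: "nat \<Rightarrow> real"
      show "(\<Sum>h<r. \<Sum>h'<r. D h h' * s h * s h') \<le> \<gamma> * (\<Sum>h<r. s h)\<^sup>2"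
        using V[rule_format, of "vec r s"] by simp
    qed
  qed simp
  finally show ?thesis unfolding group_affine_iff_excess .
qed

end

section \<open>Optimality\<close>

theorem theorem14:
  fixes r k1 k2 :: nat
  assumes "k1 \<ge> k2" and "k2 \<ge> 2" and "2 \<le> r" and "r \<le> k1 + k2 - 1"
  shows
    "(gamma k1 k2 \<le> (real r - 1) / real r \<longrightarrow>
        (\<forall>d \<in> design_class r k1 k2. \<forall>n. group_affine r k1 k2 d n \<and> n \<le> n_gamma k1 k2 \<longrightarrow>
           E_optimal r k1 k2 d))
     \<and>
     (gamma k1 k2 \<le> (real r - 1) / real r \<and>
      (\<exists>d \<in> design_class r k1 k2. \<exists>n. group_affine r k1 k2 d n \<and> n \<le> n_gamma k1 k2) \<longrightarrow>
        {d \<in> design_class r k1 k2. E_optimal r k1 k2 d} =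
        {d \<in> design_class r k1 k2. \<exists>n. group_affine r k1 k2 d n \<and> n \<le> n_gamma k1 k2})
     \<and>
     (gamma k1 k2 \<ge> (real r - 1) / real r \<longrightarrow>
        (\<forall>d \<in> design_class r k1 k2. equal_concurrence r d (theta_bar k1 k2 + 1) \<longrightarrow>
           Schur_optimal r k1 k2 d))"
proof -
  let ?c = "gram_scale k1 k2" and ?g = "gamma k1 k2"
  have loc: "connected_resolvable r k1 k2 d" if "d \<in> design_class r k1 k2" for d
    using assms that by unfold_locales (auto simp: design_class_def)
  have upper: "eigval r k1 k2 d 1 \<le> real r - (1 + ?c * ?g)"
    if "?g \<le> (real r - 1) / real r" "d \<in> design_class r k1 k2" for d
    using connected_resolvable.eigval_1_le[OF loc[OF that(2)] that(1)] .
  have attained: "real r - (1 + ?c * ?g) \<le> eigval r k1 k2 d 1 \<longleftrightarrow>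
      (\<exists>n. group_affine r k1 k2 d n \<and> n \<le> n_gamma k1 k2)" if "d \<in> design_class r k1 k2" for d
    using connected_resolvable.eigval_1_ge_iff_group_affine[OF loc[OF that]] .
  have a: "E_optimal r k1 k2 d"
    if "?g \<le> (real r - 1) / real r" "d \<in> design_class r k1 k2"
      "group_affine r k1 k2 d n" "n \<le> n_gamma k1 k2" for d n
    unfolding E_optimal_def using upper[OF that(1)] attained[OF that(2)] that by (meson order_trans)
  have b: "\<exists>n. group_affine r k1 k2 d n \<and> n \<le> n_gamma k1 k2"
    if "d0 \<in> design_class r k1 k2" "group_affine r k1 k2 d0 n0" "n0 \<le> n_gamma k1 k2"
      "E_optimal r k1 k2 d" for d d0 n0
  proof -
    have d: "d \<in> design_class r k1 k2" and le: "eigval r k1 k2 d0 1 \<le> eigval r k1 k2 d 1"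
      using that(1,4) by (auto simp: E_optimal_def)
    have "real r - (1 + ?c * ?g) \<le> eigval r k1 k2 d0 1" using attained[OF that(1)] that(2,3) by blast
    with le attained[OF d] show ?thesis by (meson order_trans)
  qed
  have c: "Schur_optimal r k1 k2 d"
    if g: "?g \<ge> (real r - 1) / real r" and d: "d \<in> design_class r k1 k2"
      and ecd: "equal_concurrence r d (theta_bar k1 k2 + 1)" for d
    unfolding Schur_optimal_def
  proof (intro conjI d allI impI ballI)
    fix f :: "real \<Rightarrow> real" and d'
    assume f: "convex_on {0<..} f" and d': "d' \<in> design_class r k1 k2"
    interpret E: connected_resolvable r k1 k2 d by (rule loc[OF d])
    interpret F: connected_resolvable r k1 k2 d' by (rule loc[OF d'])
    let ?b = "?c * (1 - ?g)" and ?N = "r - 1"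
    let ?M = "image_mset (\<lambda>\<mu>. real r - \<mu>) (proots (char_poly F.G))"
    have b: "?b > 0" using F.c_pos gamma_bounds[OF F.k1, of k2] by simp
    have "real r - 1 \<le> real r * ?g" using g F.r_pos by (simp add: field_simps)
    then have "(real r - 1) * (1 - ?g) \<le> ?g" by (simp add: algebra_simps)
    then have "?c * ((real r - 1) * (1 - ?g)) \<le> ?c * ?g" using F.c_pos by (intro mult_left_mono) auto
    then have "(real r - 1) * ?b \<le> ?c * ?g" by (simp add: mult_ac)
    then obtain \<mu> where \<mu>: "\<mu> \<in># proots (char_poly F.G)" "1 + (real r - 1) * ?b \<le> \<mu>"
      using F.G_eigenvalue_exceeds by (metis add_left_mono order_trans)
    \<comment> \<open>Both spectra have the same sum because every Gram matrix has trace \<open>r\<close>.\<close>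
    have sum: "sum_mset ?M = (real r - (1 + (real r - 1) * ?b)) + real ?N * (real r - (1 - ?b))"
    proof -
      have "sum_mset ?M = real r * real r - sum_mset (proots (char_poly F.G))"
        unfolding sum_mset_diff_const symmetric_size_spectrum[OF F.G_carrier F.G_sym] ..
      also have "sum_mset (proots (char_poly F.G)) = real r"
        unfolding symmetric_trace[OF F.G_carrier F.G_sym] by (simp add: F.G_diag)
      finally show ?thesis using assms(3) by (simp add: of_nat_diff algebra_simps)
    qed
    have "f (real r - (1 + (real r - 1) * ?b)) + real ?N * f (real r - (1 - ?b)) \<le> (\<Sum>x\<in>#?M. f x)"
    proof (rule two_level_mset_minimizes_convex_sum[OF f _ _ _ _ sum])
      show "set_mset ?M \<subseteq> {0<..}"
        using F.G_eigenvalue_less[OF F.r_less F.conn] by auto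
      show "size ?M = Suc ?N"
        using assms(3) by (simp add: symmetric_size_spectrum[OF F.G_carrier F.G_sym])
      show "real r - \<mu> \<in># ?M" using \<mu>(1) by auto
      have "(real r - 1) * ?b \<ge> 0" using b assms(3) by (intro mult_nonneg_nonneg[OF _ less_imp_le]) auto
      then show "real r - (1 + (real r - 1) * ?b) \<le> real r - (1 - ?b)" using b by linarith
    qed (use assms(3) \<mu>(2) in auto)
    then show "(\<Sum>i = 1..k1 + k2 - 1. f (eigval r k1 k2 d i))
        \<le> (\<Sum>i = 1..k1 + k2 - 1. f (eigval r k1 k2 d' i))"
      unfolding E.sum_eigval F.sum_eigval E.ecd_spectrum[OF ecd assms(3)] by simp
  qed
  show ?thesis using a b c by blast
qed

end
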